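(* Let $F$ be a field of characteristic $0$ and let $g\in\mathbb N$. (a) Let $f\in F\langle X_1,\dots,X_g,Y_1,\dots,Y_g\rangle$. If $f(A,B)=0$ for all $n\in\mathbb N$ and all $(A,B)=(A_1,\dots,A_g,B_1,\dots,B_g)\in M_n(F)^{2g}$ such that $A_jB_j=I_n$ for $j=1,\dots,g$, then $f\in(1-X_1Y_1,\,1-Y_1X_1,\,\dots,\,1-X_gY_g,\,1-Y_gX_g)$. (b) Let $f\in F\langle X_1,\dots,X_g,Y_1,\dots,Y_g\rangle$. If $f(A,B)=0$ for all $n\in\mathbb N$ and all $(A,B)=(A_1,\dots,A_g,B_1,\dots,B_g)\in M_n(F)^{2g}$ with $A_1B_1+\cdots+A_gB_g=I_n$, then $f\in(1-X_1Y_1-\cdots-X_gY_g)$. (c) Let $f\in F\langle X_{ij},Y_{ij}: 1\le i,j\le g\rangle$. If $f(A,B)=0$ for all $n\in\mathbb N$ and all $(A,B)\in M_n(F)^{2g^2}$, $A=(A_{ij})_{ij}$, $B=(B_{ij})_{ij}$, such that the block matrices satisfy $(A_{ij})_{ij}(B_{ij})_{ij}=I_{gn}$, then $$f\in\Big(\delta_{ij}-\sum_{k=1}^g X_{ik}Y_{kj},\ \delta_{ij}-\sum_{k=1}^g Y_{ik}X_{kj}\ :\ 1\le i,j\le g\Big),$$ where $\delta_{ij}$ denotes Kronecker's delta.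
   Context: $F\langle\cdots\rangle$ denotes the free associative unital $F$-algebra in the listed freely noncommuting variables, and $(\cdots)$ denotes the two-sided ideal generated by the listed elements. $M_n(F)$ is the algebra of $n\times n$ matrices over $F$ and $I_n$ is the identity matrix. A polynomial is evaluated at a tuple of $n\times n$ matrices by substituting the matrices for the corresponding variables. In (c), $(A_{ij})_{ij}$ and $(B_{ij})_{ij}$ are viewed as $gn\times gn$ matrices with $n\times n$ blocks $A_{ij}$, $B_{ij}$.
   Formalization: Part (b) is stated and proved for g ≠ 1 only: for g = 1 it is false, since f = 1 − Y_1X_1 vanishes whenever A_1B_1 = I_n but does not lie in (1 − X_1Y_1), as the two shifts on sequences show. *)

theory Defs
  imports
    "HOL-Library.Poly_Mapping"
    "HOL-Algebra.Ideal"
    "Jordan_Normal_Form.Matrix"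
begin

text \<open>
  Words over an alphabet form the free monoid, written additively because the convolution product
  of \<open>HOL-Library.Poly_Mapping\<close> expects an additive monoid of exponents. Consequently
  \<open>('v, 'a) ncpoly\<close>, the monoid algebra of that free monoid over \<open>'a\<close>, is the free unital
  associative algebra on all of \<open>'v\<close>, and its ring structure is the one provided by the library.
\<close>

datatype 'v word = Word (letters: "'v list")

instantiation word :: (type) monoid_add
begin

definition zero_word :: "'a word" where
  "0 = Word []"

definition plus_word :: "'a word \<Rightarrow> 'a word \<Rightarrow> 'a word" where
  "u + v = Word (letters u @ letters v)"

instance
  by standard (simp_all add: zero_word_def plus_word_def)

end

type_synonym ('v, 'a) ncpoly = "'v word \<Rightarrow>\<^sub>0 'a"

definition ncvar :: "'v \<Rightarrow> ('v, 'a::zero_neq_one) ncpoly" where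
  "ncvar v = Poly_Mapping.single (Word [v]) 1"

text \<open>
  \<open>free_algebra V\<close> is the free algebra on the variables in \<open>V\<close> only. It is set up as a
  \<open>HOL-Algebra\<close> ring so that \<open>Idl\<close>, the two-sided ideal generated by a set, refers to this
  algebra and not to the algebra on the whole type \<open>'v\<close>.
\<close>

definition free_algebra :: "'v set \<Rightarrow> ('v, 'a::ring_1) ncpoly ring" where
  "free_algebra V =
    \<lparr>carrier = {f. \<forall>w\<in>Poly_Mapping.keys f. set (letters w) \<subseteq> V},
     monoid.mult = (*), one = 1, zero = 0, add = (+)\<rparr>"

text \<open>
  Evaluation at \<open>n \<times> n\<close> matrices \<open>P v\<close>; the empty word evaluates to the identity matrix.
\<close>

definition eval_word :: "nat \<Rightarrow> ('v \<Rightarrow> 'a::semiring_1 mat) \<Rightarrow> 'v word \<Rightarrow> 'a mat" where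
  "eval_word n P w = foldr (\<lambda>v M. P v * M) (letters w) (1\<^sub>m n)"

definition eval_ncpoly :: "nat \<Rightarrow> ('v \<Rightarrow> 'a::semiring_1 mat) \<Rightarrow> ('v, 'a) ncpoly \<Rightarrow> 'a mat" where
  "eval_ncpoly n P f =
    finsum (module_mat TYPE('a) n n) (\<lambda>w. Poly_Mapping.lookup f w \<cdot>\<^sub>m eval_word n P w)
      (Poly_Mapping.keys f)"

datatype 'i var = X 'i | Y 'i

definition XY :: "'i set \<Rightarrow> 'i var set" where
  "XY I = X ` I \<union> Y ` I"

text \<open>
  The \<open>gn \<times> gn\<close> matrix whose \<open>(i, j)\<close> block, for \<open>i, j < g\<close>, is the \<open>n \<times> n\<close> matrix
  \<open>A (i, j)\<close>.
\<close>

definition block_mat :: "nat \<Rightarrow> nat \<Rightarrow> (nat \<times> nat \<Rightarrow> 'a mat) \<Rightarrow> 'a mat" where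
  "block_mat g n A =
    mat (g * n) (g * n) (\<lambda>(r, c). A (r div n, c div n) $$ (r mod n, c mod n))"

lemma ring_free_algebra: "ring (free_algebra V :: ('v, 'a::ring_1) ncpoly ring)"
proof -
  let ?R = "free_algebra V :: ('v, 'a) ncpoly ring"
  have plus: "f + h \<in> carrier ?R" if "f \<in> carrier ?R" "h \<in> carrier ?R" for f h
    using that Poly_Mapping.keys_add[of f h] unfolding free_algebra_def by auto
  have times: "f * h \<in> carrier ?R" if "f \<in> carrier ?R" "h \<in> carrier ?R" for f h
  proof -
    have "set (letters w) \<subseteq> V" if w: "w \<in> Poly_Mapping.keys (f * h)" for w
    proof -
      obtain u v where "w = u + v" "u \<in> Poly_Mapping.keys f" "v \<in> Poly_Mapping.keys h"
        using w keys_mult[of f h] by auto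
      then show ?thesis
        using \<open>f \<in> carrier ?R\<close> \<open>h \<in> carrier ?R\<close>
        by (simp add: free_algebra_def plus_word_def)
    qed
    then show ?thesis
      by (simp add: free_algebra_def)
  qed
  have minus: "- f \<in> carrier ?R" if "f \<in> carrier ?R" for f
    using that by (simp add: free_algebra_def)
  have zero: "0 \<in> carrier ?R" and one: "1 \<in> carrier ?R"
    by (simp_all add: free_algebra_def zero_word_def)
  have ops: "\<zero>\<^bsub>?R\<^esub> = 0" "\<one>\<^bsub>?R\<^esub> = 1" "f \<oplus>\<^bsub>?R\<^esub> h = f + h" "f \<otimes>\<^bsub>?R\<^esub> h = f * h" for f h
    by (simp_all add: free_algebra_def)
  show ?thesis
  proof (rule ringI)
    show "abelian_group ?R"
    proof (rule abelian_groupI)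
      fix f assume "f \<in> carrier ?R"
      then show "\<exists>h\<in>carrier ?R. h \<oplus>\<^bsub>?R\<^esub> f = \<zero>\<^bsub>?R\<^esub>"
        by (intro bexI[of _ "- f"] minus) (simp_all add: ops)
    qed (simp_all add: ops plus zero add_ac)
    show "Group.monoid ?R"
      by (rule Group.monoidI) (simp_all add: ops times one mult.assoc)
  qed (simp_all add: ops distrib_left distrib_right)
qed

lemma ncvar_in_free_algebra:
  "v \<in> V \<Longrightarrow> (ncvar v :: ('v, 'a::ring_1) ncpoly) \<in> carrier (free_algebra V)"
  by (simp add: ncvar_def free_algebra_def)

text \<open>
  For the single relation \<open>X\<^sub>1 Y\<^sub>1 + \<dots> + X\<^sub>g Y\<^sub>g = 1\<close> the case \<open>g = 1\<close> has to be left out: square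
  matrices with \<open>A B = 1\<close> also satisfy \<open>B A = 1\<close>, so \<open>1 - Y X\<close> vanishes on all of them, but it is
  not in the ideal generated by \<open>1 - X Y\<close>, as the two shifts on sequences show.
\<close>

end

theory Submission
  imports Defs "HOL-Library.Function_Algebras"
begin

text \<open>
  Each part says that an ideal \<open>I\<close> of a free algebra is cut out by finite-dimensional
  representations. There is always one faithful representation of the quotient algebra, namely its
  action on itself by left multiplication: it sends the unit to the class of \<open>f\<close> when \<open>f\<close> is
  substituted, so it detects whether \<open>f\<close> is in \<open>I\<close>. It is infinite-dimensional, but evaluating
  a polynomial of degree at most \<open>N\<close> at the unit only involves the finite-dimensional space of
  classes of degree at most \<open>N\<close>. One may therefore change the operators outside that space, and it
  suffices to do so in such a way that the defining relations hold exactly on some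
  finite-dimensional space (\<open>membership_criterion\<close>).

  For relations that express that \<open>X\<close> and \<open>Y\<close> are inverse matrices, left multiplication by \<open>X\<close> is
  injective on columns, and an injective map from a subspace into a finite-dimensional space extends
  to an automorphism of that space. It can be arranged that the inverse automorphism extends
  left multiplication by \<open>Y\<close> in low degrees (\<open>invertible_truncation\<close>).

  For the single relation \<open>\<Sum>j. X j Y j = 1\<close>, the operators are cut off arbitrarily beyond low
  degrees. The error made in the relation vanishes on low degrees and is corrected with the help of a
  second copy of the space (\<open>nullstellensatz_right_invertible_row\<close>); this uses two distinct indices \<open>j\<close>.
\<close>

section \<open>Linear maps prescribed on subspaces\<close>

context vector_space begin

text \<open>
  Projecting along \<open>I\<close> onto a complement represents the quotient by \<open>I\<close> inside the space itself:
  \<open>\<rho> x\<close> is a representative of the class of \<open>x\<close>, chosen linearly.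
\<close>

lemma exists_projection_with_kernel:
  assumes "subspace I"
  shows "\<exists>\<rho>. Vector_Spaces.linear scale scale \<rho> \<and> (\<forall>x. \<rho> x = 0 \<longleftrightarrow> x \<in> I) \<and> (\<forall>x. x - \<rho> x \<in> I)"
proof -
  interpret vp: vector_space_pair scale scale ..
  have "Vector_Spaces.linear scale scale id"
    by (simp add: linear_id)
  from vp.linear_exists_left_inverse_on[OF this assms]
  obtain p where p: "range p \<subseteq> I" "Vector_Spaces.linear scale scale p" "\<And>v. v \<in> I \<Longrightarrow> p v = v"
    by auto
  have "Vector_Spaces.linear scale scale (\<lambda>x. x - p x)"
    by (intro vp.linear_compose_sub p linear_ident)
  moreover have "x - p x = 0 \<longleftrightarrow> x \<in> I" for x
    using p(1,3) by (metis eq_iff_diff_eq_0 range_subsetD)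
  moreover have "x - (x - p x) \<in> I" for x
    using p(1) by auto
  ultimately show ?thesis by blast
qed

text \<open>
  Composing \<open>T\<close> with a projection onto \<open>P\<close> keeps the range as small as possible; this is what
  later confines truncated operators to a finite-dimensional space.
\<close>

lemma linear_extension_from_subspace:
  assumes "subspace P" and T: "Vector_Spaces.linear scale scale T"
  shows "\<exists>A. Vector_Spaces.linear scale scale A \<and> (\<forall>x\<in>P. A x = T x) \<and> range A \<subseteq> T ` P"
proof -
  interpret vp: vector_space_pair scale scale ..
  have "Vector_Spaces.linear scale scale id"
    by (simp add: linear_id)
  from vp.linear_exists_left_inverse_on[OF this assms(1)]
  obtain p where p: "range p \<subseteq> P" "Vector_Spaces.linear scale scale p" "\<And>v. v \<in> P \<Longrightarrow> p v = v"
    by auto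
  have "Vector_Spaces.linear scale scale (T \<circ> p)"
    using p(2) T by (rule Vector_Spaces.linear_compose)
  then show ?thesis
    using p by (intro exI[of _ "T \<circ> p"]) auto
qed

text \<open>
  Extend a basis of \<open>P\<close> and its image under \<open>T\<close> to two bases of \<open>Q\<close>. Both have \<open>dim Q\<close> elements,
  so equally many were added on each side, and any bijection between the added vectors completes
  \<open>T\<close> to an automorphism of \<open>Q\<close>.
\<close>

lemma injection_extends_to_automorphism:
  assumes P: "subspace P" and Q: "subspace Q" and PQ: "P \<subseteq> Q"
    and fin: "finite F" "Q \<subseteq> span F"
    and T: "Vector_Spaces.linear scale scale T" and inj: "inj_on T P" and TP: "T ` P \<subseteq> Q"
  shows "\<exists>A B. Vector_Spaces.linear scale scale A \<and> Vector_Spaces.linear scale scale B \<and>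
    (\<forall>x\<in>P. A x = T x) \<and> (\<forall>x\<in>Q. A x \<in> Q \<and> B x \<in> Q \<and> A (B x) = x \<and> B (A x) = x)"
proof -
  interpret vp: vector_space_pair scale scale ..
  obtain b where b: "b \<subseteq> P" "independent b" "P \<subseteq> span b"
    using maximal_independent_subset by blast
  have spb: "span b = P"
    using b P by (simp add: span_subspace)
  obtain c where c: "b \<subseteq> c" "c \<subseteq> Q" "independent c" "Q \<subseteq> span c"
    using maximal_independent_subset_extend[of b Q] b(1,2) PQ by blast
  have spc: "span c = Q"
    using c Q by (simp add: span_subspace)
  have Tb: "independent (T ` b)"
    using vp.linear_independent_injective_image[OF T b(2)] inj spb by simp
  obtain d where d: "T ` b \<subseteq> d" "d \<subseteq> Q" "independent d" "Q \<subseteq> span d"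
    using maximal_independent_subset_extend[OF _ Tb, of Q] b(1) TP by blast
  have spd: "span d = Q"
    using d Q by (simp add: span_subspace)
  have finc: "finite c" and find: "finite d"
    using independent_span_bound[OF fin(1) c(3)] independent_span_bound[OF fin(1) d(3)] c(2) d(2) fin(2)
    by auto
  have "card c = card d"
    using basis_card_eq_dim[OF c(2,4,3)] basis_card_eq_dim[OF d(2,4,3)] by simp
  moreover have injb: "inj_on T b"
    using inj b(1) inj_on_subset by blast
  then have "card (T ` b) = card b"
    by (rule card_image)
  ultimately have "card (c - b) = card (d - T ` b)"
    using finc find c(1) d(1) by (simp add: card_Diff_subset finite_subset)
  then obtain h where h: "bij_betw h (c - b) (d - T ` b)"
    using finc find by (meson finite_Diff finite_same_card_bij)
  define \<phi> where "\<phi> x = (if x \<in> b then T x else h x)" for x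
  have \<phi>: "bij_betw \<phi> c d"
  proof -
    have "bij_betw \<phi> b (T ` b)"
      using injb by (auto simp: bij_betw_def \<phi>_def inj_on_def)
    moreover have "bij_betw \<phi> (c - b) (d - T ` b)"
      using h by (rule bij_betw_cong[THEN iffD1, rotated]) (simp add: \<phi>_def)
    ultimately have "bij_betw \<phi> (b \<union> (c - b)) (T ` b \<union> (d - T ` b))"
      by (rule bij_betw_combine) auto
    then show ?thesis
      using c(1) d(1) by (simp add: Un_absorb1)
  qed
  define A where "A = vp.construct c \<phi>"
  have A: "Vector_Spaces.linear scale scale A"
    unfolding A_def by (rule vp.linear_construct[OF c(3)])
  have Ac: "A x = \<phi> x" if "x \<in> c" for x
    unfolding A_def using vp.construct_basis[OF c(3) that] .
  have AT: "A x = T x" if "x \<in> P" for x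
    using vp.linear_eq_on[OF A T, of x b] that spb c(1) by (metis Ac \<phi>_def subsetD)
  have Acd: "A ` c = d" and injAc: "inj_on A c"
    using \<phi> Ac by (auto simp: bij_betw_def inj_on_def)
  have AQ: "A ` Q = Q"
    using vp.linear_span_image[OF A, of c] Acd spc spd by simp
  have "inj_on A Q"
    using vp.linear_inj_on_span_independent_image[OF A, of c] d(3) Acd injAc spc by simp
  from vp.linear_exists_left_inverse_on[OF A Q this]
  obtain B where B: "range B \<subseteq> Q" "Vector_Spaces.linear scale scale B" "\<And>x. x \<in> Q \<Longrightarrow> B (A x) = x"
    by auto
  have "A (B x) = x" if "x \<in> Q" for x
    using that AQ B(3) by (metis imageE)
  then show ?thesis
    using A B AT AQ by blast
qed

text \<open>
  Two operators that are inverse to each other on \<open>U\<close> can be replaced by two that are inverse to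
  each other on a whole finite-dimensional space \<open>Q\<close>, without changing either of them on \<open>U\<close>.
  Demanding that \<open>A\<close> extend \<open>T\<close> on \<open>U\<close> and that the inverse of \<open>A\<close> extend \<open>S\<close> on \<open>U\<close> prescribes \<open>A\<close> on
  \<open>U + S U\<close>, where it has to be \<open>T\<close> because \<open>T S = 1\<close>; and \<open>T\<close> is injective there because also
  \<open>S T = 1\<close>.
\<close>

lemma invertible_truncation:
  assumes U: "subspace U" and Q: "subspace Q" and UQ: "U \<subseteq> Q"
    and fin: "finite F" "Q \<subseteq> span F"
    and T: "Vector_Spaces.linear scale scale T" and S: "Vector_Spaces.linear scale scale S"
    and TQ: "T ` U \<subseteq> Q" and SQ: "S ` U \<subseteq> Q"
    and TS: "\<And>u. u \<in> U \<Longrightarrow> T (S u) = u" and ST: "\<And>u. u \<in> U \<Longrightarrow> S (T u) = u"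
  shows "\<exists>A B. Vector_Spaces.linear scale scale A \<and> Vector_Spaces.linear scale scale B \<and>
    (\<forall>u\<in>U. A u = T u \<and> B u = S u) \<and>
    (\<forall>x\<in>Q. A x \<in> Q \<and> B x \<in> Q \<and> A (B x) = x \<and> B (A x) = x)"
proof -
  interpret vp: vector_space_pair scale scale ..
  interpret T: Vector_Spaces.linear scale scale T by fact
  interpret S: Vector_Spaces.linear scale scale S by fact
  define P where "P = {u + v |u v. u \<in> U \<and> v \<in> S ` U}"
  have P: "subspace P"
    unfolding P_def by (intro subspace_sums U S.subspace_image)
  have UP: "U \<subseteq> P" and SP: "S ` U \<subseteq> P"
    unfolding P_def using subspace_0[OF U] S.zero by force+
  have PQ: "P \<subseteq> Q"
    unfolding P_def using UQ SQ Q by (auto intro: subspace_add)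
  have TP: "T ` P \<subseteq> Q"
    unfolding P_def using TS TQ UQ Q by (force simp: T.add intro: subspace_add)
  have "x = 0" if "x \<in> P" "T x = 0" for x
  proof -
    from \<open>x \<in> P\<close> obtain u v where x: "x = u + S v" and uv: "u \<in> U" "v \<in> U"
      unfolding P_def by auto
    have "T u + v = 0"
      using that(2) uv by (simp add: x T.add TS)
    then have "v = - T u"
      by (simp add: add_eq_0_iff)
    then show ?thesis
      using uv by (simp add: x S.neg ST)
  qed
  then have "inj_on T P"
    using T.inj_on_iff_eq_0[OF P] by blast
  from injection_extends_to_automorphism[OF P Q PQ fin T this TP]
  obtain A B where AB: "Vector_Spaces.linear scale scale A" "Vector_Spaces.linear scale scale B"
    "\<And>x. x \<in> P \<Longrightarrow> A x = T x"
    "\<And>x. x \<in> Q \<Longrightarrow> A x \<in> Q \<and> B x \<in> Q \<and> A (B x) = x \<and> B (A x) = x"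
    by blast
  have "B u = S u" if "u \<in> U" for u
  proof -
    have "A (S u) = u"
      using that AB(3) SP TS by auto
    then show ?thesis
      using AB(4)[of "S u"] that SQ by auto
  qed
  then show ?thesis
    using AB UP by blast
qed

end

section \<open>Matrices of operators\<close>

lemma finsum_mat:
  fixes M :: "'i \<Rightarrow> 'a::comm_ring_1 mat"
  assumes "finite I" "\<And>i. i \<in> I \<Longrightarrow> M i \<in> carrier_mat n n"
  shows "finsum (module_mat TYPE('a) n n) M I = mat n n (\<lambda>(r, c). \<Sum>i\<in>I. M i $$ (r, c))"
  using assms
proof (induction I rule: finite_induct)
  case empty
  interpret abelian_group "module_mat TYPE('a) n n"
    by (rule abelian_group_mat)
  show ?case
    by (subst finsum_empty) (auto simp: module_mat_simps)
next
  case (insert i I)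
  interpret abelian_group "module_mat TYPE('a) n n"
    by (rule abelian_group_mat)
  have "finsum (module_mat TYPE('a) n n) M (insert i I) =
      M i + finsum (module_mat TYPE('a) n n) M I"
    using insert.hyps insert.prems
    by (subst finsum_insert) (auto simp: module_mat_simps)
  also have "\<dots> = mat n n (\<lambda>(r, c). \<Sum>i\<in>insert i I. M i $$ (r, c))"
    using insert.hyps insert.prems by (subst insert.IH) (auto intro!: eq_matI)
  finally show ?case .
qed

text \<open>
  The operator counterpart of \<^const>\<open>eval_word\<close>, for operators on an arbitrary space.
\<close>

definition act_word :: "('v \<Rightarrow> 'b \<Rightarrow> 'b) \<Rightarrow> 'v word \<Rightarrow> 'b \<Rightarrow> 'b" where
  "act_word op w = foldr op (letters w)"

text \<open>
  The passage from operators to matrices. Matrices have to represent operators on the span of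
  finitely many vectors only, while the operators themselves are total functions on a possibly
  infinite-dimensional type; \<open>endo\<close> singles out those for which the matrix is meaningful.
\<close>

locale coordinates = vector_space scale
  for scale :: "'a::field \<Rightarrow> 'b::ab_group_add \<Rightarrow> 'b" +
  fixes b :: "nat \<Rightarrow> 'b" and n :: nat
  assumes inj_b: "inj_on b {..<n}" and indep_b: "independent (b ` {..<n})"
begin

abbreviation V :: "'b set" where
  "V \<equiv> span (b ` {..<n})"

definition coord :: "nat \<Rightarrow> 'b \<Rightarrow> 'a" where
  "coord r y = representation (b ` {..<n}) y (b r)"

definition mat_of :: "('b \<Rightarrow> 'b) \<Rightarrow> 'a mat" where
  "mat_of L = mat n n (\<lambda>(r, c). coord r (L (b c)))"

definition endo :: "('b \<Rightarrow> 'b) \<Rightarrow> bool" where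
  "endo L \<longleftrightarrow> Vector_Spaces.linear scale scale L \<and> L ` V \<subseteq> V"

lemma endoD: "endo L \<Longrightarrow> y \<in> V \<Longrightarrow> L y \<in> V"
  by (auto simp: endo_def)

lemma basis_in_V: "r < n \<Longrightarrow> b r \<in> V"
  by (simp add: span_base)

lemma coord_sum: "(\<And>i. i \<in> I \<Longrightarrow> v i \<in> V) \<Longrightarrow> coord r (\<Sum>i\<in>I. v i) = (\<Sum>i\<in>I. coord r (v i))"
  by (simp add: coord_def representation_sum[OF indep_b])

lemma coord_scale: "y \<in> V \<Longrightarrow> coord r (scale k y) = k * coord r y"
  by (simp add: coord_def representation_scale[OF indep_b])

lemma coord_basis: "r < n \<Longrightarrow> c < n \<Longrightarrow> coord r (b c) = of_bool (r = c)"
  using inj_b by (auto simp: coord_def representation_basis[OF indep_b] inj_on_def)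

lemma coord_zero: "coord r 0 = 0"
  by (simp add: coord_def representation_zero)

lemma coord_expansion: "y \<in> V \<Longrightarrow> (\<Sum>r<n. scale (coord r y) (b r)) = y"
  using sum_representation_eq[OF indep_b, of y "b ` {..<n}"]
  by (simp add: coord_def sum.reindex[OF inj_b])

lemma mat_of_carrier [simp]: "mat_of L \<in> carrier_mat n n"
  by (simp add: mat_of_def)

lemma mat_of_cong: "(\<And>y. y \<in> V \<Longrightarrow> L y = L' y) \<Longrightarrow> mat_of L = mat_of L'"
  by (auto simp: mat_of_def basis_in_V intro!: eq_matI)

lemma mat_of_id: "mat_of (\<lambda>y. y) = 1\<^sub>m n"
  by (auto simp: mat_of_def coord_basis intro!: eq_matI)

lemma mat_of_comp:
  assumes L: "endo L" and L': "endo L'"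
  shows "mat_of (\<lambda>y. L (L' y)) = mat_of L * mat_of L'"
proof (rule eq_matI)
  fix r c assume rc: "r < dim_row (mat_of L * mat_of L')" "c < dim_col (mat_of L * mat_of L')"
  interpret L: Vector_Spaces.linear scale scale L
    using L by (simp add: endo_def)
  have rc: "r < n" "c < n"
    using rc by (simp_all add: mat_of_def)
  let ?k = "\<lambda>k. coord k (L' (b c))"
  have y: "L' (b c) \<in> V"
    using L' basis_in_V[OF rc(2)] by (auto simp: endo_def)
  have "coord r (L (L' (b c))) = coord r (\<Sum>k<n. scale (?k k) (L (b k)))"
    by (subst coord_expansion[OF y, symmetric]) (simp add: L.sum L.scale)
  also have "\<dots> = (\<Sum>k<n. coord r (L (b k)) * ?k k)"
    by (subst coord_sum) (auto simp: coord_scale endoD[OF L] basis_in_V mult.commute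
        intro!: span_scale sum.cong)
  finally show "mat_of (\<lambda>y. L (L' y)) $$ (r, c) = (mat_of L * mat_of L') $$ (r, c)"
    using rc by (simp add: mat_of_def scalar_prod_def lessThan_atLeast0)
qed (simp_all add: mat_of_def)

lemma finsum_mat_of:
  assumes "finite I" "\<And>i y. i \<in> I \<Longrightarrow> y \<in> V \<Longrightarrow> L i y \<in> V"
  shows "finsum (module_mat TYPE('a) n n) (\<lambda>i. mat_of (L i)) I = mat_of (\<lambda>y. \<Sum>i\<in>I. L i y)"
  using assms(2) basis_in_V
  by (subst finsum_mat[OF assms(1)]) (auto simp: mat_of_def coord_sum intro!: eq_matI)

lemma finsum_mult_mat_of:
  assumes "finite I" and endo: "\<And>i. i \<in> I \<Longrightarrow> endo (L i)" "\<And>i. i \<in> I \<Longrightarrow> endo (L' i)"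
  shows "finsum (module_mat TYPE('a) n n) (\<lambda>i. mat_of (L i) * mat_of (L' i)) I =
    mat_of (\<lambda>y. \<Sum>i\<in>I. L i (L' i y))"
proof -
  have "finsum (module_mat TYPE('a) n n) (\<lambda>i. mat_of (L i) * mat_of (L' i)) I =
      finsum (module_mat TYPE('a) n n) (\<lambda>i. mat_of (\<lambda>y. L i (L' i y))) I"
    using assms(1) by (subst (1 2) finsum_mat) (auto simp: mat_of_comp endo
        intro!: mult_carrier_mat[of _ n n] eq_matI sum.cong)
  also have "\<dots> = mat_of (\<lambda>y. \<Sum>i\<in>I. L i (L' i y))"
    using assms(1) by (intro finsum_mat_of) (simp_all add: endoD[OF endo(1)] endoD[OF endo(2)])
  finally show ?thesis .
qed

lemma mat_of_eq_zeroD: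
  assumes L: "endo L" and "mat_of L = 0\<^sub>m n n" and y: "y \<in> V"
  shows "L y = 0"
proof -
  interpret L: Vector_Spaces.linear scale scale L
    using L by (simp add: endo_def)
  have "L (b c) = 0" if "c < n" for c
  proof -
    have "coord r (L (b c)) = 0" if "r < n" for r
      using arg_cong[OF assms(2), of "\<lambda>M. M $$ (r, c)"] that \<open>c < n\<close> by (simp add: mat_of_def)
    moreover have "L (b c) \<in> V"
      using L basis_in_V[OF that] by (auto simp: endo_def)
    ultimately show ?thesis
      using coord_expansion[of "L (b c)"] by simp
  qed
  then show ?thesis
    by (subst coord_expansion[OF y, symmetric]) (simp add: L.sum L.scale)
qed

lemma endo_act_word:
  assumes "\<And>v. v \<in> set (letters w) \<Longrightarrow> endo (op v)"
  shows "endo (act_word op w)" and "eval_word n (\<lambda>v. mat_of (op v)) w = mat_of (act_word op w)"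
proof -
  have "endo (foldr op vs) \<and> foldr (\<lambda>v M. mat_of (op v) * M) vs (1\<^sub>m n) = mat_of (foldr op vs)"
    if "\<And>v. v \<in> set vs \<Longrightarrow> endo (op v)" for vs
    using that
  proof (induction vs)
    case Nil
    then show ?case
      using mat_of_id by (simp add: endo_def linear_id id_def[abs_def] linear_ident)
  next
    case (Cons v vs)
    then have "endo (op v)" "endo (foldr op vs)"
      by simp_all
    then have "endo (\<lambda>y. op v (foldr op vs y))"
      using Vector_Spaces.linear_compose[of scale scale "foldr op vs" scale "op v"]
      by (auto simp: endo_def comp_def)
    with Cons show ?case
      using mat_of_comp[of "op v" "foldr op vs"] by (simp add: comp_def)
  qed
  then show "endo (act_word op w)" "eval_word n (\<lambda>v. mat_of (op v)) w = mat_of (act_word op w)"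
    using assms by (simp_all add: act_word_def eval_word_def)
qed

text \<open>
  \<^const>\<open>eval_ncpoly\<close> at the matrices of the operators is the matrix of the operator obtained by
  substituting the operators into \<open>f\<close>. In dimension \<open>0\<close> the conclusion is automatic, so
  vanishing is assumed in positive dimension only.
\<close>

lemma eval_zero_imp_action_zero:
  assumes op: "\<And>w v. w \<in> Poly_Mapping.keys f \<Longrightarrow> v \<in> set (letters w) \<Longrightarrow> endo (op v)"
    and "n > 0 \<Longrightarrow> eval_ncpoly n (\<lambda>v. mat_of (op v)) f = 0\<^sub>m n n" and y: "y \<in> V"
  shows "(\<Sum>w\<in>Poly_Mapping.keys f. scale (Poly_Mapping.lookup f w) (act_word op w y)) = 0"
proof -
  let ?L = "\<lambda>w y. scale (Poly_Mapping.lookup f w) (act_word op w y)"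
  interpret vp: vector_space_pair scale scale ..
  have w: "endo (act_word op w)" "eval_word n (\<lambda>v. mat_of (op v)) w = mat_of (act_word op w)"
    if "w \<in> Poly_Mapping.keys f" for w
    using endo_act_word[of w op, OF op[OF that]] by simp_all
  have L: "endo (?L w)" if "w \<in> Poly_Mapping.keys f" for w
    using w(1)[OF that] by (auto simp: endo_def intro!: vp.linear_compose_scale_right span_scale)
  have M: "Poly_Mapping.lookup f w \<cdot>\<^sub>m eval_word n (\<lambda>v. mat_of (op v)) w = mat_of (?L w)"
    if "w \<in> Poly_Mapping.keys f" for w
    using w[OF that] basis_in_V
    by (auto simp: mat_of_def endo_def image_subset_iff coord_scale intro!: eq_matI)
  have "eval_ncpoly n (\<lambda>v. mat_of (op v)) f =
      finsum (module_mat TYPE('a) n n) (\<lambda>w. mat_of (?L w)) (Poly_Mapping.keys f)"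
    unfolding eval_ncpoly_def
    by (subst (1 2) finsum_mat) (auto simp: M intro!: eq_matI sum.cong)
  also have "\<dots> = mat_of (\<lambda>y. \<Sum>w\<in>Poly_Mapping.keys f. ?L w y)"
    using L by (intro finsum_mat_of) (auto simp: endo_def)
  finally have eval: "eval_ncpoly n (\<lambda>v. mat_of (op v)) f = mat_of (\<lambda>y. \<Sum>w\<in>Poly_Mapping.keys f. ?L w y)" .
  have "mat_of (\<lambda>y. \<Sum>w\<in>Poly_Mapping.keys f. ?L w y) = 0\<^sub>m n n"
  proof (cases "n = 0")
    case True
    then have "\<not> r < n" for r
      by simp
    then show ?thesis
      by (intro eq_matI) (simp_all add: mat_of_def)
  next
    case False
    then show ?thesis
      using assms(2) eval by simp
  qed
  moreover have "endo (\<lambda>y. \<Sum>w\<in>Poly_Mapping.keys f. ?L w y)"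
    using L by (auto simp: endo_def intro!: vp.linear_compose_sum span_sum)
  ultimately show ?thesis
    using mat_of_eq_zeroD y by blast
qed

end

lemma (in vector_space) exists_coordinates:
  assumes "subspace V" "finite F" "V \<subseteq> span F"
  obtains b :: "nat \<Rightarrow> 'b" and n where "coordinates scale b n" "span (b ` {..<n}) = V"
proof -
  obtain B where B: "B \<subseteq> V" "independent B" "V \<subseteq> span B"
    using maximal_independent_subset by blast
  have "finite B"
    using independent_span_bound[OF assms(2) B(2)] B(1) assms(3) by blast
  then obtain b :: "nat \<Rightarrow> 'b" and n where b: "B = b ` {i. i < n}" "inj_on b {i. i < n}"
    using finite_imp_nat_seg_image_inj_on by blast
  have "coordinates scale b n"
    using b B(2) by unfold_locales (simp_all add: lessThan_def)
  moreover have "span (b ` {..<n}) = V"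
    using b B assms(1) by (simp add: lessThan_def span_subspace)
  ultimately show thesis
    using that by blast
qed

section \<open>Quotients of free algebras, truncated by degree\<close>

text \<open>
  Scalars act through the constant polynomials, so that scalar multiples stay in an ideal for the
  same reason as products do.
\<close>

definition smul :: "'a::comm_ring_1 \<Rightarrow> ('v, 'a) ncpoly \<Rightarrow> ('v, 'a) ncpoly" where
  "smul k f = Poly_Mapping.single 0 k * f"

lemma smul_single: "smul k (Poly_Mapping.single w x) = Poly_Mapping.single w (k * x)"
  by (simp add: smul_def mult_single)

lemma sum_monomials: "(\<Sum>w\<in>Poly_Mapping.keys f. Poly_Mapping.single w (Poly_Mapping.lookup f w)) = f"
proof (rule poly_mapping_eqI)
  fix u
  have "Poly_Mapping.lookup (\<Sum>w\<in>Poly_Mapping.keys f. Poly_Mapping.single w (Poly_Mapping.lookup f w)) u =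
      (\<Sum>w\<in>Poly_Mapping.keys f. if w = u then Poly_Mapping.lookup f u else 0)"
    unfolding lookup_sum by (rule sum.cong) (auto simp: lookup_single when_def)
  then show "Poly_Mapping.lookup (\<Sum>w\<in>Poly_Mapping.keys f. Poly_Mapping.single w (Poly_Mapping.lookup f w)) u =
      Poly_Mapping.lookup f u"
    by (simp add: in_keys_iff)
qed

lemma ncpoly_expansion:
  fixes f :: "('v, 'a::comm_ring_1) ncpoly"
  shows "(\<Sum>w\<in>Poly_Mapping.keys f. smul (Poly_Mapping.lookup f w) (Poly_Mapping.single w 1)) = f"
  using sum_monomials[of f] by (simp add: smul_single)

lemma mult_smul: "f * smul k h = smul k (f * h)"
proof -
  have "f * Poly_Mapping.single 0 k = Poly_Mapping.single 0 k * f"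
    by (subst (1 2) sum_monomials[of f, symmetric])
      (simp add: sum_distrib_left sum_distrib_right mult_single mult.commute)
  then show ?thesis
    by (metis smul_def mult.assoc)
qed

interpretation ncpoly: vector_space "smul :: 'a::field \<Rightarrow> ('v, 'a) ncpoly \<Rightarrow> ('v, 'a) ncpoly"
proof
  fix a b :: 'a and x y :: "('v, 'a) ncpoly"
  show "smul a (x + y) = smul a x + smul a y"
    by (simp add: smul_def distrib_left)
  show "smul (a + b) x = smul a x + smul b x"
    by (simp add: smul_def single_add distrib_right)
  show "smul a (smul b x) = smul (a * b) x"
    by (simp add: smul_def mult.assoc[symmetric] mult_single)
  show "smul 1 x = x"
    by (simp add: smul_def)
qed

lemma linear_mult_left:
  "Vector_Spaces.linear smul smul (\<lambda>y. f * y :: ('v, 'a::field) ncpoly)"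
  by unfold_locales (simp_all add: distrib_left mult_smul)

lemma free_algebra_closed:
  fixes f h :: "('v, 'a::comm_ring_1) ncpoly"
  assumes "f \<in> carrier (free_algebra Vars)"
  shows "h \<in> carrier (free_algebra Vars) \<Longrightarrow> f + h \<in> carrier (free_algebra Vars)"
    and "h \<in> carrier (free_algebra Vars) \<Longrightarrow> f * h \<in> carrier (free_algebra Vars)"
    and "h \<in> carrier (free_algebra Vars) \<Longrightarrow> f - h \<in> carrier (free_algebra Vars)"
    and "smul k f \<in> carrier (free_algebra Vars)"
proof -
  interpret ring "free_algebra Vars :: ('v, 'a) ncpoly ring"
    by (rule ring_free_algebra)
  have *: "- h \<in> carrier (free_algebra Vars)" if "h \<in> carrier (free_algebra Vars)" for h :: "('v, 'a) ncpoly"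
    using that by (simp add: free_algebra_def)
  show add: "f + h \<in> carrier (free_algebra Vars)"
    if "h \<in> carrier (free_algebra Vars)" for h :: "('v, 'a) ncpoly"
    using assms that a_closed[of f h] by (simp add: free_algebra_def)
  show "f * h \<in> carrier (free_algebra Vars)" if "h \<in> carrier (free_algebra Vars)"
    using assms that m_closed[of f h] by (simp add: free_algebra_def)
  show "f - h \<in> carrier (free_algebra Vars)" if "h \<in> carrier (free_algebra Vars)"
    using add[OF *[OF that]] by simp
  have "Poly_Mapping.single 0 k \<in> carrier (free_algebra Vars)"
    by (simp add: free_algebra_def zero_word_def)
  then show "smul k f \<in> carrier (free_algebra Vars)"
    using m_closed[of "Poly_Mapping.single 0 k" f] assms by (simp add: free_algebra_def smul_def)
qed

lemma one_zero_in_free_algebra: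
  "1 \<in> carrier (free_algebra Vars)" "0 \<in> carrier (free_algebra Vars)"
  by (simp_all add: free_algebra_def zero_word_def)

lemma sum_in_free_algebra:
  fixes f :: "'i \<Rightarrow> ('v, 'a::comm_ring_1) ncpoly"
  shows "(\<And>i. i \<in> J \<Longrightarrow> f i \<in> carrier (free_algebra Vars)) \<Longrightarrow> sum f J \<in> carrier (free_algebra Vars)"
  by (induction J rule: infinite_finite_induct)
    (auto simp: one_zero_in_free_algebra intro!: free_algebra_closed)

lemma exists_degree_bound: "\<exists>N. \<forall>w\<in>Poly_Mapping.keys f. length (letters w) \<le> N"
  by (rule exI[of _ "Max ((\<lambda>w. length (letters w)) ` Poly_Mapping.keys f)"]) auto

text \<open>
  The quotient of the free algebra by \<open>I\<close>, realised inside the free algebra: \<open>\<rho>\<close> picks one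
  representative in every residue class and does so linearly. The range of \<open>\<rho>\<close> then plays the role
  of the quotient, \<open>\<rho> 1\<close> that of its unit, \<open>lmul v\<close> that of left multiplication by the class of
  the variable \<open>v\<close>, and \<open>level k\<close> that of the classes of polynomials of degree at most \<open>k\<close>. The
  levels are finite-dimensional because there are only finitely many variables.
\<close>

locale free_algebra_quotient =
  fixes Vars :: "'v set" and I :: "('v, 'a::field) ncpoly set"
    and \<rho> :: "('v, 'a) ncpoly \<Rightarrow> ('v, 'a) ncpoly"
  assumes finite_Vars: "finite Vars"
    and ideal_I: "ideal I (free_algebra Vars)"
    and linear_rho: "Vector_Spaces.linear smul smul \<rho>"
    and rho_eq_0_iff: "\<rho> f = 0 \<longleftrightarrow> f \<in> I"
    and diff_rho_in_I: "f - \<rho> f \<in> I"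
begin

sublocale rho: Vector_Spaces.linear smul smul \<rho>
  by (rule linear_rho)

abbreviation K :: "('v, 'a) ncpoly set" where
  "K \<equiv> carrier (free_algebra Vars)"

definition lmul :: "'v \<Rightarrow> ('v, 'a) ncpoly \<Rightarrow> ('v, 'a) ncpoly" where
  "lmul v y = \<rho> (ncvar v * y)"

definition level :: "nat \<Rightarrow> ('v, 'a) ncpoly set" where
  "level k = \<rho> ` {f \<in> K. \<forall>w\<in>Poly_Mapping.keys f. length (letters w) \<le> k}"

lemma I_sub_K: "i \<in> I \<Longrightarrow> i \<in> K"
  using additive_subgroup.a_subset[OF ideal.axioms(1)[OF ideal_I]] by blast

lemma I_mult:
  assumes "i \<in> I" "f \<in> K"
  shows "f * i \<in> I" "i * f \<in> I"
  using ideal.I_l_closed[OF ideal_I assms] ideal.I_r_closed[OF ideal_I assms]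
  by (simp_all add: free_algebra_def)

lemma rho_cong: "f - h \<in> I \<Longrightarrow> \<rho> f = \<rho> h"
  using rho_eq_0_iff[of "f - h"] by (simp add: rho.diff)

lemma rho_rho: "\<rho> (\<rho> f) = \<rho> f"
  using rho_cong[OF diff_rho_in_I] by simp

lemma rho_in_K: "f \<in> K \<Longrightarrow> \<rho> f \<in> K"
  using free_algebra_closed(3)[OF _ I_sub_K[OF diff_rho_in_I], of f f] by simp

text \<open>
  Left multiplication is well defined on classes because \<open>I\<close> is a left ideal.
\<close>

lemma rho_mult_rho: "f \<in> K \<Longrightarrow> \<rho> (f * \<rho> h) = \<rho> (f * h)"
  using rho_cong[of "f * h" "f * \<rho> h"] I_mult(1)[OF diff_rho_in_I, of f h]
  by (simp add: right_diff_distrib)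

lemma linear_lmul: "Vector_Spaces.linear smul smul (lmul v)"
  using Vector_Spaces.linear_compose[OF linear_mult_left[of "ncvar v"] linear_rho]
  by (simp add: lmul_def[abs_def] comp_def)

lemma lmul_rho: "v \<in> Vars \<Longrightarrow> lmul v (\<rho> f) = \<rho> (ncvar v * f)"
  by (simp add: lmul_def rho_mult_rho ncvar_in_free_algebra)

lemma level_in_K: "u \<in> level k \<Longrightarrow> u \<in> K" and rho_level: "u \<in> level k \<Longrightarrow> \<rho> u = u"
  by (auto simp: level_def rho_in_K rho_rho)

lemma level_mono: "k \<le> l \<Longrightarrow> level k \<subseteq> level l"
  unfolding level_def by (intro image_mono) force

lemma rho_one_in_level: "\<rho> 1 \<in> level k"
proof -
  have "(1 :: ('v, 'a) ncpoly) \<in> {f \<in> K. \<forall>w\<in>Poly_Mapping.keys f. length (letters w) \<le> k}"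
    by (simp add: free_algebra_def zero_word_def)
  then show ?thesis
    unfolding level_def by blast
qed

lemma lmul_level:
  assumes "v \<in> Vars" "u \<in> level k"
  shows "lmul v u \<in> level (Suc k)"
proof -
  obtain f where f: "u = \<rho> f" "f \<in> K" "\<And>w. w \<in> Poly_Mapping.keys f \<Longrightarrow> length (letters w) \<le> k"
    using assms(2) by (auto simp: level_def)
  have "length (letters w) \<le> Suc k" if "w \<in> Poly_Mapping.keys (ncvar v * f)" for w
    using that keys_mult[of "ncvar v" f] f(3)
    by (fastforce simp: ncvar_def plus_word_def split: if_splits)
  then have "\<rho> (ncvar v * f) \<in> level (Suc k)"
    using f(2) assms(1) unfolding level_def by (intro imageI) (simp add: free_algebra_closed ncvar_in_free_algebra)
  then show ?thesis
    using f(1) assms(1) by (simp add: lmul_rho)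
qed

lemma subspace_level: "ncpoly.subspace (level k)"
  unfolding level_def
proof (intro rho.subspace_image ncpoly.subspaceI CollectI conjI ballI)
  fix f h :: "('v, 'a) ncpoly" and c w
  assume f: "f \<in> {f \<in> K. \<forall>w\<in>Poly_Mapping.keys f. length (letters w) \<le> k}"
  then show "smul c f \<in> K"
    by (simp add: free_algebra_closed)
  show "length (letters w) \<le> k" if "w \<in> Poly_Mapping.keys (smul c f)"
    using that f keys_mult[of "Poly_Mapping.single 0 c" f]
    by (fastforce simp: smul_def plus_word_def zero_word_def split: if_splits)
  assume h: "h \<in> {f \<in> K. \<forall>w\<in>Poly_Mapping.keys f. length (letters w) \<le> k}"
  show "f + h \<in> K"
    using f h by (simp add: free_algebra_closed)
  show "length (letters w) \<le> k" if "w \<in> Poly_Mapping.keys (f + h)"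
    using that f h Poly_Mapping.keys_add[of f h] by blast
qed (simp_all add: free_algebra_def)

lemma finite_span_level: "\<exists>F. finite F \<and> level k \<subseteq> ncpoly.span F"
proof -
  define B where "B = (\<lambda>vs. Poly_Mapping.single (Word vs) (1 :: 'a)) ` {vs. set vs \<subseteq> Vars \<and> length vs \<le> k}"
  have "finite B"
    unfolding B_def using finite_Vars by (intro finite_imageI finite_lists_length_le)
  have "f \<in> ncpoly.span B" if f: "f \<in> K" "\<forall>w\<in>Poly_Mapping.keys f. length (letters w) \<le> k" for f
  proof -
    have "Poly_Mapping.single w 1 \<in> B" if "w \<in> Poly_Mapping.keys f" for w
    proof -
      have "set (letters w) \<subseteq> Vars \<and> length (letters w) \<le> k"
        using that f by (simp add: free_algebra_def)
      then have "Poly_Mapping.single (Word (letters w)) 1 \<in> B"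
        unfolding B_def by blast
      then show ?thesis by simp
    qed
    then show ?thesis
      by (subst ncpoly_expansion[of f, symmetric])
        (intro ncpoly.span_sum ncpoly.span_scale ncpoly.span_base)
  qed
  then have "level k \<subseteq> \<rho> ` ncpoly.span B"
    unfolding level_def by blast
  then show ?thesis
    using \<open>finite B\<close> rho.span_image[of B] by (intro exI[of _ "\<rho> ` B"]) auto
qed

text \<open>
  A relator that lies in \<open>I\<close> kills the quotient from the left, because \<open>I\<close> is a right ideal. The
  value \<open>of_bool P\<close> covers the diagonal and the off-diagonal entries of a matrix identity.
\<close>

lemma lmul_relation:
  assumes xy: "\<And>i. i \<in> J \<Longrightarrow> x i \<in> Vars \<and> y i \<in> Vars"
    and rel: "of_bool P - (\<Sum>i\<in>J. ncvar (x i) * ncvar (y i)) \<in> I"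
    and u: "u \<in> level k"
  shows "(\<Sum>i\<in>J. lmul (x i) (lmul (y i) u)) = (if P then u else 0)"
proof -
  have uK: "u \<in> K" and \<rho>u: "\<rho> u = u"
    using u by (simp_all add: level_in_K rho_level)
  let ?r = "of_bool P - (\<Sum>i\<in>J. ncvar (x i) * ncvar (y i))"
  have "lmul (x i) (lmul (y i) u) = \<rho> (ncvar (x i) * ncvar (y i) * u)" if "i \<in> J" for i
    unfolding lmul_def[of "y i"] using xy[OF that] by (simp add: lmul_rho mult.assoc)
  then have "(\<Sum>i\<in>J. lmul (x i) (lmul (y i) u)) = \<rho> ((\<Sum>i\<in>J. ncvar (x i) * ncvar (y i)) * u)"
    by (simp add: rho.sum sum_distrib_right)
  also have "\<dots> = \<rho> (of_bool P * u)"
  proof (rule sym, rule rho_cong)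
    show "of_bool P * u - (\<Sum>i\<in>J. ncvar (x i) * ncvar (y i)) * u \<in> I"
      using I_mult(2)[OF rel uK] by (simp only: left_diff_distrib)
  qed
  also have "\<dots> = (if P then u else 0)"
    by (simp add: \<rho>u)
  finally show ?thesis .
qed

text \<open>
  A word of length at most \<open>N\<close> applied to the unit never leaves the classes of degree at
  most \<open>N\<close>. Hence operators that agree with left multiplication
  on \<open>level N\<close> cannot be told apart from it by such a word.
\<close>

lemma act_word_rho_one:
  assumes agree: "\<And>v u. v \<in> Vars \<Longrightarrow> u \<in> level N \<Longrightarrow> L v (\<iota> u) = \<iota> (lmul v u)"
    and w: "set (letters w) \<subseteq> Vars" "length (letters w) \<le> N"
  shows "act_word L w (\<iota> (\<rho> 1)) = \<iota> (\<rho> (Poly_Mapping.single w 1))"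
proof -
  have "foldr L vs (\<iota> (\<rho> 1)) = \<iota> (\<rho> (Poly_Mapping.single (Word vs) 1))"
    if "set vs \<subseteq> Vars" "length vs \<le> N" for vs
    using that
  proof (induction vs)
    case Nil
    then show ?case
      by (simp add: zero_word_def[symmetric])
  next
    case (Cons v vs)
    have "\<rho> (Poly_Mapping.single (Word vs) 1) \<in> level N"
      using Cons.prems unfolding level_def by (intro imageI) (simp add: free_algebra_def)
    moreover have "(ncvar v * Poly_Mapping.single (Word vs) 1 :: ('v, 'a) ncpoly) = Poly_Mapping.single (Word (v # vs)) 1"
      by (simp add: ncvar_def mult_single plus_word_def)
    ultimately show ?case
      using Cons by (simp add: agree lmul_rho)
  qed
  from this[OF w] show ?thesis
    by (simp add: act_word_def)
qed

text \<open>
  The heart of the argument. If operators on a finite-dimensional space agree with left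
  multiplication on a copy of \<open>level N\<close>, then substituting them into a polynomial of degree at most
  \<open>N\<close> and applying the result to the unit gives the residue class of that polynomial. So the
  polynomial lies in \<open>I\<close> as soon as it vanishes at the matrices of these operators. The embedding
  \<open>\<iota>\<close> leaves room for a space larger than the quotient itself.
\<close>

lemma membership_criterion:
  fixes s :: "'a \<Rightarrow> 'b::ab_group_add \<Rightarrow> 'b" and M :: "'v \<Rightarrow> 'a mat"
  assumes E: "coordinates s b n"
    and \<iota>: "Vector_Spaces.linear smul s \<iota>" "\<And>y. \<iota> y = 0 \<Longrightarrow> y = 0"
    and one: "\<iota> (\<rho> 1) \<in> module.span s (b ` {..<n})"
    and endo: "\<And>v. v \<in> Vars \<Longrightarrow> coordinates.endo s b n (L v)"
    and agree: "\<And>v u. v \<in> Vars \<Longrightarrow> u \<in> level N \<Longrightarrow> L v (\<iota> u) = \<iota> (lmul v u)"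
    and f: "f \<in> K" "\<forall>w\<in>Poly_Mapping.keys f. length (letters w) \<le> N"
    and eval: "n > 0 \<Longrightarrow> eval_ncpoly n (\<lambda>v. coordinates.mat_of s b n (L v)) f = 0\<^sub>m n n"
  shows "f \<in> I"
proof -
  interpret E: coordinates s b n by (rule E)
  interpret \<iota>: Vector_Spaces.linear smul s \<iota> by (rule \<iota>(1))
  have w: "set (letters w) \<subseteq> Vars" if "w \<in> Poly_Mapping.keys f" for w
    using f(1) that by (simp add: free_algebra_def)
  have "0 = (\<Sum>w\<in>Poly_Mapping.keys f. s (Poly_Mapping.lookup f w) (act_word L w (\<iota> (\<rho> 1))))"
    using w by (intro E.eval_zero_imp_action_zero[symmetric] endo eval one) auto
  also have "\<dots> = (\<Sum>w\<in>Poly_Mapping.keys f. \<iota> (\<rho> (smul (Poly_Mapping.lookup f w) (Poly_Mapping.single w 1))))"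
    using w f(2) by (intro sum.cong refl)
      (simp add: act_word_rho_one[where L = L and \<iota> = \<iota> and N = N] agree \<iota>.scale rho.scale)
  also have "\<dots> = \<iota> (\<rho> f)"
    by (simp add: \<iota>.sum[symmetric] rho.sum[symmetric] ncpoly_expansion)
  finally show ?thesis
    using \<iota>(2) rho_eq_0_iff by metis
qed

end

lemma free_algebra_quotient_exists:
  fixes I :: "('v, 'a::field) ncpoly set"
  assumes "finite Vars" "ideal I (free_algebra Vars)"
  obtains \<rho> where "free_algebra_quotient Vars I \<rho>"
proof -
  interpret ideal I "free_algebra Vars" by fact
  have *: "Poly_Mapping.single 0 c \<in> carrier (free_algebra Vars)" for c :: 'a
    by (simp add: free_algebra_def zero_word_def)
  have "ncpoly.subspace I"
  proof (rule ncpoly.subspaceI)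
    show "0 \<in> I"
      using additive_subgroup.zero_closed[OF ideal.axioms(1)[OF assms(2)]]
      by (simp add: free_algebra_def)
    show "f + h \<in> I" if "f \<in> I" "h \<in> I" for f h
      using additive_subgroup.a_closed[OF ideal.axioms(1)[OF assms(2)] that]
      by (simp add: free_algebra_def)
    show "smul c f \<in> I" if "f \<in> I" for c f
      using I_l_closed[OF that *] by (simp add: free_algebra_def smul_def)
  qed
  from ncpoly.exists_projection_with_kernel[OF this] assms that show thesis
    unfolding free_algebra_quotient_def by blast
qed

lemma genideal_quotient:
  fixes S :: "('v, 'a::field) ncpoly set"
  assumes "finite Vars" "S \<subseteq> carrier (free_algebra Vars)"
  obtains \<rho> where "free_algebra_quotient Vars (Idl\<^bsub>free_algebra Vars\<^esub> S) \<rho>"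
    and "S \<subseteq> Idl\<^bsub>free_algebra Vars\<^esub> S"
proof -
  interpret ring "free_algebra Vars :: ('v, 'a) ncpoly ring"
    by (rule ring_free_algebra)
  show thesis
    using free_algebra_quotient_exists[OF assms(1) genideal_ideal[OF assms(2)]]
      genideal_self[OF assms(2)] that by blast
qed

section \<open>Columns and block matrices\<close>

text \<open>
  Column vectors with entries in a vector space are functions on \<open>nat\<close> that vanish from some index
  on; the number of entries then remains an ordinary variable.
\<close>

definition fun_scale :: "('a \<Rightarrow> 'b \<Rightarrow> 'b) \<Rightarrow> 'a \<Rightarrow> (nat \<Rightarrow> 'b) \<Rightarrow> nat \<Rightarrow> 'b" where
  "fun_scale s k h = (\<lambda>i. s k (h i))"

definition blk :: "nat \<Rightarrow> 'b::zero \<Rightarrow> nat \<Rightarrow> 'b" where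
  "blk j v = (\<lambda>i. if i = j then v else 0)"

definition blocks :: "nat \<Rightarrow> 'b::zero set \<Rightarrow> (nat \<Rightarrow> 'b) set" where
  "blocks g S = {h. \<forall>i. if i < g then h i \<in> S else h i = 0}"

lemma sum_fun_apply: "(\<Sum>j\<in>J. F j) i = (\<Sum>j\<in>J. F j i)"
  by (induction J rule: infinite_finite_induct) simp_all

lemma blocks_expansion:
  fixes h :: "nat \<Rightarrow> 'b::comm_monoid_add"
  shows "h \<in> blocks g S \<Longrightarrow> (\<Sum>j<g. blk j (h j)) = h"
  by (rule ext) (auto simp: sum_fun_apply blk_def blocks_def)

context vector_space begin

lemma vector_space_fun_scale: "vector_space (fun_scale scale)"
  by unfold_locales (auto simp: fun_scale_def fun_eq_iff scale_right_distrib scale_left_distrib)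

lemma linear_blk: "Vector_Spaces.linear scale (fun_scale scale) (blk j)"
  unfolding Vector_Spaces.linear_iff using vector_space_fun_scale vector_space_axioms
  by (auto simp: fun_scale_def blk_def fun_eq_iff)

lemma linear_component: "Vector_Spaces.linear (fun_scale scale) scale (\<lambda>h. h i)"
  unfolding Vector_Spaces.linear_iff using vector_space_fun_scale vector_space_axioms
  by (auto simp: fun_scale_def)

lemma subspace_blocks:
  assumes "subspace S"
  shows "module.subspace (fun_scale scale) (blocks g S)"
proof -
  interpret fv: vector_space "fun_scale scale"
    by (rule vector_space_fun_scale)
  show ?thesis
    using assms
    by (intro fv.subspaceI)
      (auto simp: blocks_def fun_scale_def subspace_0 subspace_add subspace_scale)
qed

lemma blk_in_blocks: "subspace S \<Longrightarrow> v \<in> S \<Longrightarrow> j < g \<Longrightarrow> blk j v \<in> blocks g S"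
  by (simp add: blocks_def blk_def subspace_0)

lemma finite_span_blocks:
  assumes "finite F" "S \<subseteq> span F"
  shows "\<exists>F'. finite F' \<and> blocks g S \<subseteq> module.span (fun_scale scale) F'"
proof -
  interpret fv: vector_space "fun_scale scale"
    by (rule vector_space_fun_scale)
  define F' where "F' = (\<Union>j<g. blk j ` F)"
  have "h \<in> fv.span F'" if h: "h \<in> blocks g S" for h
  proof -
    have "blk j (h j) \<in> fv.span F'" if "j < g" for j
    proof -
      interpret blk: Vector_Spaces.linear scale "fun_scale scale" "blk j"
        by (rule linear_blk)
      have "blk j (h j) \<in> blk j ` span F"
        using h that assms(2) by (intro imageI) (auto simp: blocks_def)
      also have "\<dots> = fv.span (blk j ` F)"
        by (simp add: blk.span_image)
      also have "\<dots> \<subseteq> fv.span F'"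
        using that by (intro fv.span_mono) (auto simp: F'_def)
      finally show ?thesis .
    qed
    then have "(\<Sum>j<g. blk j (h j)) \<in> fv.span F'"
      by (intro fv.span_sum) simp
    then show ?thesis
      by (simp add: blocks_expansion[OF h])
  qed
  moreover have "finite F'"
    using assms(1) by (simp add: F'_def)
  ultimately show ?thesis by blast
qed

end

text \<open>
  Row and column indices of block matrices split into a block number and a position in the block.
\<close>

lemma sum_blocks: "(\<Sum>t<g * n. f (t div n) (t mod n)) = (\<Sum>k<g. \<Sum>m<n. f k m)"
  for f :: "nat \<Rightarrow> nat \<Rightarrow> 'b::comm_monoid_add"
proof -
  have "(\<Sum>t<g * n. f (t div n) (t mod n)) = (\<Sum>k<g. \<Sum>t = k * n..<k * n + n. f (t div n) (t mod n))"
    by (rule sum.nat_group[symmetric])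
  also have "\<dots> = (\<Sum>k<g. \<Sum>m<n. f k m)"
  proof (rule sum.cong[OF refl])
    fix k
    have "(\<Sum>t = k * n..<k * n + n. f (t div n) (t mod n)) =
        (\<Sum>m = 0..<n. f ((m + k * n) div n) ((m + k * n) mod n))"
      using sum.shift_bounds_nat_ivl[of "\<lambda>t. f (t div n) (t mod n)" 0 "k * n" n]
      by (simp add: add.commute)
    also have "\<dots> = (\<Sum>m<n. f k m)"
      unfolding lessThan_atLeast0 by (intro sum.cong refl) simp
    finally show "(\<Sum>t = k * n..<k * n + n. f (t div n) (t mod n)) = (\<Sum>m<n. f k m)" .
  qed
  finally show ?thesis .
qed

lemma block_mat_mult_eq_one:
  fixes A B :: "nat \<times> nat \<Rightarrow> 'a::comm_ring_1 mat"
  assumes A: "\<And>i j. i < g \<Longrightarrow> j < g \<Longrightarrow> A (i, j) \<in> carrier_mat n n"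
    and B: "\<And>i j. i < g \<Longrightarrow> j < g \<Longrightarrow> B (i, j) \<in> carrier_mat n n"
    and AB: "\<And>i j. i < g \<Longrightarrow> j < g \<Longrightarrow>
      finsum (module_mat TYPE('a) n n) (\<lambda>k. A (i, k) * B (k, j)) {..<g} = (if i = j then 1\<^sub>m n else 0\<^sub>m n n)"
  shows "block_mat g n A * block_mat g n B = 1\<^sub>m (g * n)"
proof (rule eq_matI)
  fix r c assume "r < dim_row (1\<^sub>m (g * n) :: 'a mat)" "c < dim_col (1\<^sub>m (g * n) :: 'a mat)"
  then have rc: "r < g * n" "c < g * n"
    by simp_all
  define i j where "i = r div n" and "j = c div n"
  have ij: "i < g" "j < g"
    using rc by (simp_all add: i_def j_def less_mult_imp_div_less)
  have n: "n > 0"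
    using rc by (cases n) auto
  then have m: "r mod n < n" "c mod n < n"
    by simp_all
  have "(block_mat g n A * block_mat g n B) $$ (r, c) =
      (\<Sum>t<g * n. A (i, t div n) $$ (r mod n, t mod n) * B (t div n, j) $$ (t mod n, c mod n))"
    using rc by (simp add: block_mat_def scalar_prod_def lessThan_atLeast0 i_def j_def)
  also have "\<dots> = (\<Sum>k<g. \<Sum>m<n. A (i, k) $$ (r mod n, m) * B (k, j) $$ (m, c mod n))"
    by (rule sum_blocks)
  also have "\<dots> = (\<Sum>k<g. (A (i, k) * B (k, j)) $$ (r mod n, c mod n))"
  proof (intro sum.cong refl)
    fix k assume "k \<in> {..<g}"
    then have "A (i, k) \<in> carrier_mat n n" "B (k, j) \<in> carrier_mat n n"
      using A B ij by simp_all
    then show "(\<Sum>m<n. A (i, k) $$ (r mod n, m) * B (k, j) $$ (m, c mod n)) =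
        (A (i, k) * B (k, j)) $$ (r mod n, c mod n)"
      using m by (simp add: scalar_prod_def lessThan_atLeast0)
  qed
  also have "\<dots> = finsum (module_mat TYPE('a) n n) (\<lambda>k. A (i, k) * B (k, j)) {..<g} $$ (r mod n, c mod n)"
  proof -
    have "A (i, k) * B (k, j) \<in> carrier_mat n n" if "k \<in> {..<g}" for k
      using A[OF ij(1)] B[OF _ ij(2)] that by (intro mult_carrier_mat[of _ n n]) simp_all
    then show ?thesis
      using m by (subst finsum_mat) simp_all
  qed
  also have "\<dots> = of_bool (i = j \<and> r mod n = c mod n)"
    using m by (simp add: AB[OF ij])
  also have "\<dots> = of_bool (r = c)"
  proof -
    have "r = c" if "r div n = c div n" "r mod n = c mod n"
      using that by (metis div_mult_mod_eq[of r n] div_mult_mod_eq[of c n])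
    then show ?thesis
      by (auto simp: i_def j_def)
  qed
  finally show "(block_mat g n A * block_mat g n B) $$ (r, c) = 1\<^sub>m (g * n) $$ (r, c)"
    using rc by simp
qed (simp_all add: block_mat_def)

lemma case_var_mat_of: "(\<lambda>v. M (case_var A B v)) = case_var (\<lambda>j. M (A j)) (\<lambda>j. M (B j))"
  by (auto split: var.split)

section \<open>Vanishing on matrix solutions\<close>

lemma finite_XY: "finite J \<Longrightarrow> finite (XY J)"
  by (simp add: XY_def)

lemma in_XY: "j \<in> J \<Longrightarrow> X j \<in> XY J" "j \<in> J \<Longrightarrow> Y j \<in> XY J"
  by (simp_all add: XY_def)

lemma relator_in_free_algebra:
  assumes "\<And>i. i \<in> J \<Longrightarrow> x i \<in> Vars" "\<And>i. i \<in> J \<Longrightarrow> y i \<in> Vars"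
  shows "of_bool P - (\<Sum>i\<in>J. ncvar (x i) * ncvar (y i)) \<in> (carrier (free_algebra Vars) :: ('v, 'a::comm_ring_1) ncpoly set)"
    (is "?p - ?s \<in> ?K")
proof (rule free_algebra_closed(3))
  show "?p \<in> ?K"
    by (cases P) (simp_all add: one_zero_in_free_algebra)
  show "?s \<in> ?K"
    by (intro sum_in_free_algebra free_algebra_closed(2) ncvar_in_free_algebra) (simp_all add: assms)
qed

text \<open>
  On the quotient, left multiplications by \<open>X j\<close> and \<open>Y j\<close> are inverse to each other, so for each
  \<open>j\<close> they can be truncated to inverse operators on \<open>level (Suc N)\<close>. The pairs for different \<open>j\<close>
  do not interact.
\<close>

theorem nullstellensatz_invertible_matrices:
  fixes f :: "('i var, 'a::field) ncpoly"
  assumes J: "finite J" and f: "f \<in> carrier (free_algebra (XY J))"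
    and vanish: "\<And>n A B. n > 0 \<Longrightarrow> (\<And>j. j \<in> J \<Longrightarrow> A j \<in> carrier_mat n n \<and> B j \<in> carrier_mat n n) \<Longrightarrow>
      (\<And>j. j \<in> J \<Longrightarrow> A j * B j = 1\<^sub>m n) \<Longrightarrow> eval_ncpoly n (case_var A B) f = 0\<^sub>m n n"
  shows "f \<in> Idl\<^bsub>free_algebra (XY J)\<^esub>
    ((\<lambda>j. 1 - ncvar (X j) * ncvar (Y j)) ` J \<union> (\<lambda>j. 1 - ncvar (Y j) * ncvar (X j)) ` J)"
    (is "f \<in> Idl\<^bsub>_\<^esub> ?R")
proof -
  have "?R \<subseteq> carrier (free_algebra (XY J))"
    using in_XY[of _ J]
    by (auto intro!: free_algebra_closed(2,3) simp: ncvar_in_free_algebra one_zero_in_free_algebra)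
  then obtain \<rho> where "free_algebra_quotient (XY J) (Idl\<^bsub>free_algebra (XY J)\<^esub> ?R) \<rho>"
    and R: "?R \<subseteq> Idl\<^bsub>free_algebra (XY J)\<^esub> ?R"
    using genideal_quotient[OF finite_XY[OF J]] by blast
  then interpret free_algebra_quotient "XY J" "Idl\<^bsub>free_algebra (XY J)\<^esub> ?R" \<rho>
    by simp
  obtain N where N: "\<forall>w\<in>Poly_Mapping.keys f. length (letters w) \<le> N"
    using exists_degree_bound by blast
  obtain F where F: "finite F" "level (Suc N) \<subseteq> ncpoly.span F"
    using finite_span_level by blast
  define good where "good j A B \<longleftrightarrow>
      Vector_Spaces.linear smul smul A \<and> Vector_Spaces.linear smul smul B \<and>
      (\<forall>u\<in>level N. A u = lmul (X j) u \<and> B u = lmul (Y j) u) \<and>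
      (\<forall>x\<in>level (Suc N). A x \<in> level (Suc N) \<and> B x \<in> level (Suc N) \<and> A (B x) = x \<and> B (A x) = x)"
    for j A B
  have "\<exists>A B. good j A B" if j: "j \<in> J" for j
    unfolding good_def
  proof (rule ncpoly.invertible_truncation[OF subspace_level subspace_level level_mono F linear_lmul linear_lmul])
    have "1 - ncvar (X j) * ncvar (Y j) \<in> Idl\<^bsub>free_algebra (XY J)\<^esub> ?R"
      and "1 - ncvar (Y j) * ncvar (X j) \<in> Idl\<^bsub>free_algebra (XY J)\<^esub> ?R"
      using R j by blast+
    then show "lmul (X j) (lmul (Y j) u) = u" "lmul (Y j) (lmul (X j) u) = u" if "u \<in> level N" for u
      using lmul_relation[of "{()}" "\<lambda>_. X j" "\<lambda>_. Y j" True u N]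
        lmul_relation[of "{()}" "\<lambda>_. Y j" "\<lambda>_. X j" True u N] that j
      by (simp_all add: in_XY)
  qed (use j in \<open>auto simp: lmul_level in_XY\<close>)
  then obtain A B where "\<And>j. j \<in> J \<Longrightarrow> good j (A j) (B j)"
    by metis
  note AB = this[unfolded good_def]
  obtain b :: "nat \<Rightarrow> ('i var, 'a) ncpoly" and n
    where co: "coordinates smul b n" and V: "ncpoly.span (b ` {..<n}) = level (Suc N)"
    using ncpoly.exists_coordinates[OF subspace_level F] by blast
  interpret E: coordinates smul b n by (rule co)
  have endo: "E.endo (A j)" "E.endo (B j)" if "j \<in> J" for j
    using AB[OF that] by (auto simp: E.endo_def V)
  show ?thesis
  proof (rule membership_criterion[OF co, where L = "case_var A B" and N = N and f = f and \<iota> = "\<lambda>y. y"])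
    show "Vector_Spaces.linear smul smul (\<lambda>y :: ('i var, 'a) ncpoly. y)"
      by (rule ncpoly.linear_ident)
    show "\<rho> 1 \<in> ncpoly.span (b ` {..<n})"
      by (simp add: V rho_one_in_level)
    show "E.endo (case_var A B v)" if "v \<in> XY J" for v
      using that endo by (auto simp: XY_def)
    show "case_var A B v u = lmul v u" if "v \<in> XY J" "u \<in> level N" for v u
      using that AB by (auto simp: XY_def)
    show "eval_ncpoly n (\<lambda>v. E.mat_of (case_var A B v)) f = 0\<^sub>m n n" if n: "n > 0"
      unfolding case_var_mat_of
    proof (rule vanish[OF n])
      fix j assume j: "j \<in> J"
      have "E.mat_of (A j) * E.mat_of (B j) = E.mat_of (\<lambda>y. A j (B j y))"
        using endo[OF j] by (simp add: E.mat_of_comp)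
      also have "\<dots> = E.mat_of (\<lambda>y. y)"
        using AB[OF j] V by (intro E.mat_of_cong) simp
      finally show "E.mat_of (A j) * E.mat_of (B j) = 1\<^sub>m n"
        by (simp add: E.mat_of_id)
    qed simp
  qed (use f N in auto)
qed

text \<open>
  Truncating the left multiplications to operators \<open>A0 j\<close>, \<open>B0 j\<close> of the finite-dimensional space
  \<open>Q\<close> leaves a defect \<open>D = 1 - (\<Sum>j<g. A0 j B0 j)\<close>, which vanishes on low degrees. It is repaired on
  \<open>Q \<oplus> Q\<close>. Write \<open>(v, e)\<close> for a vector. The operator \<open>B 0\<close> records \<open>D v\<close> in the second component,
  from where \<open>A 0\<close> adds it back to the first one; the second component itself is carried through
  unchanged by \<open>B 1\<close> and \<open>A 1\<close>. So the indices \<open>0\<close> and \<open>1\<close> have to be distinct, which is where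
  \<open>g \<ge> 2\<close> enters. On vectors \<open>(v, 0)\<close> with \<open>v\<close> of low degree nothing has changed. For \<open>g = 0\<close> the
  relator is \<open>1\<close> and the ideal is everything.
\<close>

theorem nullstellensatz_right_invertible_row:
  fixes f :: "(nat var, 'a::field) ncpoly"
  assumes g: "g \<noteq> 1" and f: "f \<in> carrier (free_algebra (XY {..<g}))"
    and vanish: "\<And>n A B. n > 0 \<Longrightarrow> (\<And>j. j < g \<Longrightarrow> A j \<in> carrier_mat n n \<and> B j \<in> carrier_mat n n) \<Longrightarrow>
      finsum (module_mat TYPE('a) n n) (\<lambda>j. A j * B j) {..<g} = 1\<^sub>m n \<Longrightarrow>
      eval_ncpoly n (case_var A B) f = 0\<^sub>m n n"
  shows "f \<in> Idl\<^bsub>free_algebra (XY {..<g})\<^esub> {1 - (\<Sum>j<g. ncvar (X j) * ncvar (Y j))}"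
    (is "f \<in> Idl\<^bsub>_\<^esub> {?r}")
proof -
  let ?I = "Idl\<^bsub>free_algebra (XY {..<g})\<^esub> {?r}"
  have "?r \<in> carrier (free_algebra (XY {..<g}))"
    using relator_in_free_algebra[of "{..<g}" X "XY {..<g}" Y True] by (simp add: in_XY)
  then obtain \<rho> where "free_algebra_quotient (XY {..<g}) ?I \<rho>" and "{?r} \<subseteq> ?I"
    using genideal_quotient[of "XY {..<g}" "{?r}"] finite_XY[of "{..<g}"] by blast
  then interpret free_algebra_quotient "XY {..<g}" ?I \<rho>
    by simp
  have r: "?r \<in> ?I"
    using \<open>{?r} \<subseteq> ?I\<close> by simp
  show ?thesis
  proof (cases "g = 0")
    case True
    then have "1 \<in> ?I"
      using r by simp
    from I_mult(1)[OF this f] show ?thesis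
      by simp
  next
    case False
    with g have g2: "g \<ge> 2"
      by simp
    obtain N where N: "\<forall>w\<in>Poly_Mapping.keys f. length (letters w) \<le> N"
      using exists_degree_bound by blast
    \<comment> \<open>\<open>Y j\<close> raises the degree to \<open>N + 1\<close>, and \<open>X j\<close> must still act correctly on the result.\<close>
    define Q where "Q = level (Suc (Suc N))"
    have Q: "ncpoly.subspace Q"
      by (simp add: Q_def subspace_level)
    obtain F where F: "finite F" "Q \<subseteq> ncpoly.span F"
      using finite_span_level unfolding Q_def by blast
    have relation: "(\<Sum>j<g. lmul (X j) (lmul (Y j) u)) = u" if "u \<in> level N" for u
      using lmul_relation[of "{..<g}" X Y True u N] r that by (simp add: in_XY)
    have "\<forall>j. \<exists>A. Vector_Spaces.linear smul smul A \<and> (\<forall>u\<in>level (Suc N). A u = lmul (X j) u) \<and>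
        range A \<subseteq> lmul (X j) ` level (Suc N)"
      using ncpoly.linear_extension_from_subspace[OF subspace_level linear_lmul] by blast
    from choice[OF this] obtain A0 where A0: "\<And>j. Vector_Spaces.linear smul smul (A0 j)"
      "\<And>j u. u \<in> level (Suc N) \<Longrightarrow> A0 j u = lmul (X j) u"
      "\<And>j. range (A0 j) \<subseteq> lmul (X j) ` level (Suc N)"
      by blast
    have "\<forall>j. \<exists>B. Vector_Spaces.linear smul smul B \<and> (\<forall>u\<in>level N. B u = lmul (Y j) u) \<and>
        range B \<subseteq> lmul (Y j) ` level N"
      using ncpoly.linear_extension_from_subspace[OF subspace_level linear_lmul] by blast
    from choice[OF this] obtain B0 where B0: "\<And>j. Vector_Spaces.linear smul smul (B0 j)"
      "\<And>j u. u \<in> level N \<Longrightarrow> B0 j u = lmul (Y j) u"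
      "\<And>j. range (B0 j) \<subseteq> lmul (Y j) ` level N"
      by blast
    have A0Q: "A0 j y \<in> Q" and B0Q: "B0 j y \<in> Q" if "j < g" for j y
    proof -
      have "A0 j y \<in> lmul (X j) ` level (Suc N)" "B0 j y \<in> lmul (Y j) ` level N"
        using A0(3) B0(3) by blast+
      then show "A0 j y \<in> Q" "B0 j y \<in> Q"
        using that lmul_level[of "X j" _ "Suc N"] lmul_level[of "Y j" _ N]
          level_mono[of "Suc N" "Suc (Suc N)"]
        by (auto simp: in_XY Q_def)
    qed
    define D where "D y = y - (\<Sum>j<g. A0 j (B0 j y))" for y
    have DQ: "D y \<in> Q" if "y \<in> Q" for y
      unfolding D_def using that A0Q by (intro ncpoly.subspace_diff[OF Q] ncpoly.subspace_sum[OF Q]) auto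
    have D0: "D u = 0" if u: "u \<in> level N" for u
    proof -
      have "A0 j (B0 j u) = lmul (X j) (lmul (Y j) u)" if "j < g" for j
        using u that lmul_level[of "Y j" u N] by (simp add: A0(2) B0(2) in_XY)
      then show ?thesis
        by (simp add: D_def relation[OF u])
    qed
    interpret A0: Vector_Spaces.linear smul smul "A0 j" for j by (rule A0(1))
    interpret B0: Vector_Spaces.linear smul smul "B0 j" for j by (rule B0(1))
    have D: "D (x + y) = D x + D y" "D (smul k x) = smul k (D x)" for x y k
      by (simp_all add: D_def A0.add B0.add A0.scale B0.scale sum.distrib
          ncpoly.scale_right_diff_distrib ncpoly.scale_sum_right)
    let ?s = "fun_scale (smul :: 'a \<Rightarrow> (nat var, 'a) ncpoly \<Rightarrow> (nat var, 'a) ncpoly)"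
    have vs: "vector_space ?s"
      by (rule ncpoly.vector_space_fun_scale)
    interpret fv: vector_space ?s by (rule vs)
    define A where "A j h = (\<lambda>i::nat. if i = 0 then A0 j (h 0) + (if j = 0 then h 1 else 0)
      else if i = 1 \<and> j = 1 then h 1 else 0)" for j :: nat and h :: "nat \<Rightarrow> (nat var, 'a) ncpoly"
    define B where "B j h = (\<lambda>i::nat. if i = 0 then B0 j (h 0)
      else if i = 1 then (if j = 0 then D (h 0) else if j = 1 then h 1 else 0) else 0)" for j :: nat and h :: "nat \<Rightarrow> (nat var, 'a) ncpoly"
    have linA: "Vector_Spaces.linear ?s ?s (A j)" and linB: "Vector_Spaces.linear ?s ?s (B j)" for j
      unfolding Vector_Spaces.linear_iff using vs
      by (auto simp: A_def B_def fun_scale_def fun_eq_iff A0.add A0.scale B0.add B0.scale D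
          ncpoly.scale_right_distrib)
    obtain F' where F': "finite F'" "blocks 2 Q \<subseteq> fv.span F'"
      using ncpoly.finite_span_blocks[OF F] by blast
    obtain b :: "nat \<Rightarrow> nat \<Rightarrow> (nat var, 'a) ncpoly" and n
      where co: "coordinates ?s b n" and V: "fv.span (b ` {..<n}) = blocks 2 Q"
      using fv.exists_coordinates[OF ncpoly.subspace_blocks[OF Q] F'] by blast
    interpret E: coordinates ?s b n by (rule co)
    have endo: "E.endo (A j)" "E.endo (B j)" if "j < g" for j
      using linA linB A0Q[OF that] B0Q[OF that] DQ ncpoly.subspace_0[OF Q]
      by (auto simp: E.endo_def V A_def B_def blocks_def intro!: ncpoly.subspace_add[OF Q])
    have AB: "(\<Sum>j<g. A j (B j h)) = h" if h: "h \<in> blocks 2 Q" for h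
    proof
      fix i :: nat
      consider "i = 0" | "i = 1" | "i \<ge> 2"
        by linarith
      then show "(\<Sum>j<g. A j (B j h)) i = h i"
      proof cases
        case 1
        have "A j (B j h) 0 = A0 j (B0 j (h 0)) + (if j = 0 then D (h 0) else 0)" for j
          by (simp add: A_def B_def)
        then show ?thesis
          using 1 g2 by (simp add: sum_fun_apply sum.distrib) (simp add: D_def)
      next
        case 2
        have "A j (B j h) 1 = (if j = 1 then h 1 else 0)" for j
          by (simp add: A_def B_def)
        then show ?thesis
          using 2 g2 by (simp add: sum_fun_apply)
      next
        case 3
        then show ?thesis
          using h by (simp add: sum_fun_apply A_def blocks_def)
      qed
    qed
    show ?thesis
    proof (rule membership_criterion[OF co, where L = "case_var A B" and N = N and f = f and \<iota> = "blk 0"])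
      show "Vector_Spaces.linear smul ?s (blk 0)"
        by (rule ncpoly.linear_blk)
      show "y = 0" if "blk 0 y = 0" for y :: "(nat var, 'a) ncpoly"
        using fun_cong[OF that, of 0] by (simp add: blk_def)
      have "\<rho> 1 \<in> Q"
        by (simp add: Q_def rho_one_in_level)
      then show "blk 0 (\<rho> 1) \<in> fv.span (b ` {..<n})"
        unfolding V by (intro ncpoly.blk_in_blocks[OF Q]) simp_all
      show "E.endo (case_var A B v)" if "v \<in> XY {..<g}" for v
        using that endo by (auto simp: XY_def)
      show "case_var A B v (blk 0 u) = blk 0 (lmul v u)" if "v \<in> XY {..<g}" "u \<in> level N" for v u
        using that level_mono[of N "Suc N"]
        by (auto simp: XY_def A_def B_def blk_def fun_eq_iff A0(2) B0(2) D0 subset_iff)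
      show "eval_ncpoly n (\<lambda>v. E.mat_of (case_var A B v)) f = 0\<^sub>m n n" if n: "n > 0"
        unfolding case_var_mat_of
      proof (rule vanish[OF n])
        have "finsum (module_mat TYPE('a) n n) (\<lambda>j. E.mat_of (A j) * E.mat_of (B j)) {..<g} =
            E.mat_of (\<lambda>y. \<Sum>j<g. A j (B j y))"
          using endo by (intro E.finsum_mult_mat_of) simp_all
        also have "\<dots> = E.mat_of (\<lambda>y. y)"
          using AB V by (intro E.mat_of_cong) simp
        finally show "finsum (module_mat TYPE('a) n n) (\<lambda>j. E.mat_of (A j) * E.mat_of (B j)) {..<g} = 1\<^sub>m n"
          by (simp add: E.mat_of_id)
      qed simp
    qed (use f N in auto)
  qed
qed

text \<open>
  The generic matrices \<open>X\<close> and \<open>Y\<close> act on columns of length \<open>g\<close> over the quotient, inversely to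
  each other. Truncating these two operators of columns, rather than the single entries, preserves
  the matrix relations; the entries of the truncated operators are then the required matrices.
\<close>

theorem nullstellensatz_invertible_block_matrix:
  fixes f :: "((nat \<times> nat) var, 'a::field) ncpoly"
  assumes f: "f \<in> carrier (free_algebra (XY ({..<g} \<times> {..<g})))"
    and vanish: "\<And>n A B. n > 0 \<Longrightarrow>
      (\<And>i j. i < g \<Longrightarrow> j < g \<Longrightarrow> A (i, j) \<in> carrier_mat n n \<and> B (i, j) \<in> carrier_mat n n) \<Longrightarrow>
      block_mat g n A * block_mat g n B = 1\<^sub>m (g * n) \<Longrightarrow>
      eval_ncpoly n (case_var A B) f = 0\<^sub>m n n"
  shows "f \<in> Idl\<^bsub>free_algebra (XY ({..<g} \<times> {..<g}))\<^esub>
    ((\<lambda>(i, j). of_bool (i = j) - (\<Sum>k<g. ncvar (X (i, k)) * ncvar (Y (k, j)))) ` ({..<g} \<times> {..<g}) \<union>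
     (\<lambda>(i, j). of_bool (i = j) - (\<Sum>k<g. ncvar (Y (i, k)) * ncvar (X (k, j)))) ` ({..<g} \<times> {..<g}))"
    (is "f \<in> Idl\<^bsub>_\<^esub> ?R")
proof -
  let ?V = "XY ({..<g} \<times> {..<g})"
  let ?I = "Idl\<^bsub>free_algebra ?V\<^esub> ?R"
  have in_V: "X (i, j) \<in> ?V" "Y (i, j) \<in> ?V" if "i < g" "j < g" for i j
    using that by (simp_all add: in_XY)
  have "?R \<subseteq> carrier (free_algebra ?V)"
    by (auto intro!: relator_in_free_algebra in_V)
  then obtain \<rho> where "free_algebra_quotient ?V ?I \<rho>" and R: "?R \<subseteq> ?I"
    using genideal_quotient[of ?V ?R] finite_XY[of "{..<g} \<times> {..<g}"] by blast
  then interpret free_algebra_quotient ?V ?I \<rho>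
    by simp
  have rel: "of_bool (i = j) - (\<Sum>k<g. ncvar (X (i, k)) * ncvar (Y (k, j))) \<in> ?I"
    "of_bool (i = j) - (\<Sum>k<g. ncvar (Y (i, k)) * ncvar (X (k, j))) \<in> ?I" if "i < g" "j < g" for i j
    using R that by auto
  obtain N where N: "\<forall>w\<in>Poly_Mapping.keys f. length (letters w) \<le> N"
    using exists_degree_bound by blast
  define U where "U = level N"
  define Q where "Q = level (Suc N)"
  have U: "ncpoly.subspace U" and Q: "ncpoly.subspace Q"
    by (simp_all add: U_def Q_def subspace_level)
  have UQ: "u \<in> Q" if "u \<in> U" for u
    using that level_mono[of N "Suc N"] by (auto simp: U_def Q_def)
  obtain F where F: "finite F" "Q \<subseteq> ncpoly.span F"
    using finite_span_level unfolding Q_def by blast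
  have relation:
    "(\<Sum>k<g. lmul (X (i, k)) (lmul (Y (k, j)) u)) = (if i = j then u else 0)"
    "(\<Sum>k<g. lmul (Y (i, k)) (lmul (X (k, j)) u)) = (if i = j then u else 0)"
    if "i < g" "j < g" "u \<in> U" for i j u
    using lmul_relation[OF _ rel(1)[OF that(1,2)], of u N] lmul_relation[OF _ rel(2)[OF that(1,2)], of u N]
      that by (auto simp: U_def in_V)
  interpret lmul: Vector_Spaces.linear smul smul "lmul v" for v
    by (rule linear_lmul)
  let ?s = "fun_scale (smul :: 'a \<Rightarrow> ((nat \<times> nat) var, 'a) ncpoly \<Rightarrow> ((nat \<times> nat) var, 'a) ncpoly)"
  have vs: "vector_space ?s"
    by (rule ncpoly.vector_space_fun_scale)
  interpret fv: vector_space ?s by (rule vs)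
  \<comment> \<open>The constructors \<open>X\<close> and \<open>Y\<close> are passed for \<open>Z\<close>: \<open>T X\<close> and \<open>T Y\<close> are the two generic matrices.\<close>
  define T where "T Z h = (\<lambda>i. if i < g then \<Sum>k<g. lmul (Z (i, k)) (h k) else 0)" for Z h
  have linT: "Vector_Spaces.linear ?s ?s (T Z)" for Z
    unfolding Vector_Spaces.linear_iff using vs
    by (auto simp: T_def fun_scale_def fun_eq_iff lmul.add lmul.scale sum.distrib ncpoly.scale_sum_right)
  have TQ: "T Z ` blocks g U \<subseteq> blocks g Q" if "Z = X \<or> Z = Y" for Z
    using that lmul_level[OF in_V(1), of _ _ _ N] lmul_level[OF in_V(2), of _ _ _ N]
    by (auto simp: T_def blocks_def U_def Q_def intro!: ncpoly.subspace_sum subspace_level)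
  have TT: "T Z (T Z' h) = h" if h: "h \<in> blocks g U" and Z: "(Z, Z') = (X, Y) \<or> (Z, Z') = (Y, X)" for Z Z' h
  proof
    fix i
    show "T Z (T Z' h) i = h i"
    proof (cases "i < g")
      case True
      have "T Z (T Z' h) i = (\<Sum>k<g. \<Sum>j<g. lmul (Z (i, k)) (lmul (Z' (k, j)) (h j)))"
        using True by (simp add: T_def lmul.sum)
      also have "\<dots> = (\<Sum>j<g. \<Sum>k<g. lmul (Z (i, k)) (lmul (Z' (k, j)) (h j)))"
        by (rule sum.swap)
      also have "\<dots> = (\<Sum>j<g. if i = j then h j else 0)"
        using True h Z by (intro sum.cong refl) (auto simp: relation blocks_def)
      also have "\<dots> = h i"
        using True by simp
      finally show ?thesis .
    next
      case False
      then show ?thesis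
        using h by (simp add: T_def blocks_def)
    qed
  qed
  obtain F' where F': "finite F'" "blocks g Q \<subseteq> fv.span F'"
    using ncpoly.finite_span_blocks[OF F] by blast
  have "blocks g U \<subseteq> blocks g Q"
    using UQ by (auto simp: blocks_def)
  from fv.invertible_truncation[OF ncpoly.subspace_blocks[OF U] ncpoly.subspace_blocks[OF Q] this F'
      linT[of X] linT[of Y] TQ TQ TT TT]
  obtain P S where PS: "Vector_Spaces.linear ?s ?s P" "Vector_Spaces.linear ?s ?s S"
    "\<And>u. u \<in> blocks g U \<Longrightarrow> P u = T X u \<and> S u = T Y u"
    "\<And>x. x \<in> blocks g Q \<Longrightarrow> P x \<in> blocks g Q \<and> S x \<in> blocks g Q \<and> P (S x) = x \<and> S (P x) = x"
    by blast
  define entry where "entry H = (\<lambda>(i, j) y. H (blk j y) i)"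
    for H :: "(nat \<Rightarrow> ((nat \<times> nat) var, 'a) ncpoly) \<Rightarrow> nat \<Rightarrow> ((nat \<times> nat) var, 'a) ncpoly"
  have lin_entry: "Vector_Spaces.linear smul smul (entry H p)" if "Vector_Spaces.linear ?s ?s H" for H p
  proof (cases p)
    case (Pair i j)
    then show ?thesis
      using Vector_Spaces.linear_compose[OF Vector_Spaces.linear_compose[OF ncpoly.linear_blk that]
          ncpoly.linear_component[of i], of j]
      by (simp add: entry_def comp_def)
  qed
  have entryQ: "entry H (i, j) y \<in> Q"
    if "i < g" "j < g" "y \<in> Q" "\<And>x. x \<in> blocks g Q \<Longrightarrow> H x \<in> blocks g Q" for H i j y
    using that(4)[OF ncpoly.blk_in_blocks[OF Q that(3,2)]] that(1) by (simp add: entry_def blocks_def)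
  have entryT: "T Z (blk j u) i = lmul (Z (i, j)) u" if "i < g" "j < g" for Z i j u
  proof -
    have "lmul (Z (i, k)) (blk j u k) = (if k = j then lmul (Z (i, k)) u else 0)" for k
      by (simp add: blk_def lmul.zero)
    then show ?thesis
      using that by (simp add: T_def)
  qed
  have product: "(\<Sum>k<g. entry P (i, k) (entry S (k, j) y)) = (if i = j then y else 0)"
    if "i < g" "j < g" "y \<in> Q" for i j y
  proof -
    interpret P: Vector_Spaces.linear ?s ?s P by (rule PS(1))
    have bl: "blk j y \<in> blocks g Q"
      using that by (intro ncpoly.blk_in_blocks[OF Q])
    have "(\<Sum>k<g. entry P (i, k) (entry S (k, j) y)) = P (\<Sum>k<g. blk k (S (blk j y) k)) i"
      by (simp add: entry_def P.sum sum_fun_apply)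
    also have "\<dots> = P (S (blk j y)) i"
      using blocks_expansion[of "S (blk j y)" g Q] PS(4)[OF bl] by simp
    also have "\<dots> = blk j y i"
      using PS(4)[OF bl] by simp
    finally show ?thesis
      by (simp add: blk_def)
  qed
  obtain b :: "nat \<Rightarrow> ((nat \<times> nat) var, 'a) ncpoly" and n
    where co: "coordinates smul b n" and V: "ncpoly.span (b ` {..<n}) = Q"
    using ncpoly.exists_coordinates[OF Q F] by blast
  interpret E: coordinates smul b n by (rule co)
  have endo: "E.endo (entry P (i, j))" "E.endo (entry S (i, j))" if "i < g" "j < g" for i j
    using lin_entry PS entryQ[OF that] by (auto simp: E.endo_def V)
  show ?thesis
  proof (rule membership_criterion[OF co, where L = "case_var (entry P) (entry S)" and N = N and f = f and \<iota> = "\<lambda>y. y"])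
    show "Vector_Spaces.linear smul smul (\<lambda>y :: ((nat \<times> nat) var, 'a) ncpoly. y)"
      by (rule ncpoly.linear_ident)
    show "\<rho> 1 \<in> ncpoly.span (b ` {..<n})"
      by (simp add: V Q_def rho_one_in_level)
    show "E.endo (case_var (entry P) (entry S) v)" if "v \<in> ?V" for v
      using that endo by (auto simp: XY_def)
    show "case_var (entry P) (entry S) v u = lmul v u" if "v \<in> ?V" "u \<in> level N" for v u
    proof -
      have "blk j u \<in> blocks g U" if "j < g" for j
        using \<open>u \<in> level N\<close> that by (intro ncpoly.blk_in_blocks[OF U]) (simp_all add: U_def)
      then show ?thesis
        using that(1) PS(3) by (auto simp: XY_def entry_def entryT)
    qed
    show "eval_ncpoly n (\<lambda>v. E.mat_of (case_var (entry P) (entry S) v)) f = 0\<^sub>m n n" if n: "n > 0"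
      unfolding case_var_mat_of
    proof (rule vanish[OF n])
      show "block_mat g n (\<lambda>p. E.mat_of (entry P p)) * block_mat g n (\<lambda>p. E.mat_of (entry S p)) = 1\<^sub>m (g * n)"
      proof (rule block_mat_mult_eq_one)
        fix i j assume ij: "i < g" "j < g"
        have "finsum (module_mat TYPE('a) n n) (\<lambda>k. E.mat_of (entry P (i, k)) * E.mat_of (entry S (k, j))) {..<g} =
            E.mat_of (\<lambda>y. \<Sum>k<g. entry P (i, k) (entry S (k, j) y))"
          using endo ij by (intro E.finsum_mult_mat_of) simp_all
        also have "\<dots> = E.mat_of (\<lambda>y. if i = j then y else 0)"
          using product[OF ij] V by (intro E.mat_of_cong) simp
        also have "\<dots> = (if i = j then 1\<^sub>m n else 0\<^sub>m n n)"
          by (auto simp: E.mat_of_id) (auto simp: E.mat_of_def E.coord_zero intro!: eq_matI)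
        finally show "finsum (module_mat TYPE('a) n n) (\<lambda>k. E.mat_of (entry P (i, k)) * E.mat_of (entry S (k, j))) {..<g} =
          (if i = j then 1\<^sub>m n else 0\<^sub>m n n)" .
      qed simp_all
    qed simp
  qed (use f N in auto)
qed

theorem corollary1p3:
  fixes g :: nat
  shows
    "(\<forall>f :: (nat var, 'a::field_char_0) ncpoly.
        f \<in> carrier (free_algebra (XY {..<g})) \<longrightarrow>
        (\<forall>n>0. \<forall>A B :: nat \<Rightarrow> 'a mat.
           (\<forall>j<g. A j \<in> carrier_mat n n \<and> B j \<in> carrier_mat n n) \<longrightarrow>
           (\<forall>j<g. A j * B j = 1\<^sub>m n) \<longrightarrow>
           eval_ncpoly n (case_var A B) f = 0\<^sub>m n n) \<longrightarrow>
        f \<in> Idl\<^bsub>free_algebra (XY {..<g})\<^esub>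
              ((\<lambda>j. 1 - ncvar (X j) * ncvar (Y j)) ` {..<g} \<union>
               (\<lambda>j. 1 - ncvar (Y j) * ncvar (X j)) ` {..<g}))
   \<and> (g \<noteq> 1 \<longrightarrow> (\<forall>f :: (nat var, 'a) ncpoly.
        f \<in> carrier (free_algebra (XY {..<g})) \<longrightarrow>
        (\<forall>n>0. \<forall>A B :: nat \<Rightarrow> 'a mat.
           (\<forall>j<g. A j \<in> carrier_mat n n \<and> B j \<in> carrier_mat n n) \<longrightarrow>
           finsum (module_mat TYPE('a) n n) (\<lambda>j. A j * B j) {..<g} = 1\<^sub>m n \<longrightarrow>
           eval_ncpoly n (case_var A B) f = 0\<^sub>m n n) \<longrightarrow>
        f \<in> Idl\<^bsub>free_algebra (XY {..<g})\<^esub>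
              {1 - (\<Sum>j<g. ncvar (X j) * ncvar (Y j))}))
   \<and> (\<forall>f :: ((nat \<times> nat) var, 'a) ncpoly.
        f \<in> carrier (free_algebra (XY ({..<g} \<times> {..<g}))) \<longrightarrow>
        (\<forall>n>0. \<forall>A B :: nat \<times> nat \<Rightarrow> 'a mat.
           (\<forall>i<g. \<forall>j<g. A (i, j) \<in> carrier_mat n n \<and> B (i, j) \<in> carrier_mat n n) \<longrightarrow>
           block_mat g n A * block_mat g n B = 1\<^sub>m (g * n) \<longrightarrow>
           eval_ncpoly n (case_var A B) f = 0\<^sub>m n n) \<longrightarrow>
        f \<in> Idl\<^bsub>free_algebra (XY ({..<g} \<times> {..<g}))\<^esub>
              ((\<lambda>(i, j). of_bool (i = j) - (\<Sum>k<g. ncvar (X (i, k)) * ncvar (Y (k, j))))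
                 ` ({..<g} \<times> {..<g}) \<union>
               (\<lambda>(i, j). of_bool (i = j) - (\<Sum>k<g. ncvar (Y (i, k)) * ncvar (X (k, j))))
                 ` ({..<g} \<times> {..<g})))"
proof (intro conjI allI impI)
  fix f :: "(nat var, 'a) ncpoly"
  assume "f \<in> carrier (free_algebra (XY {..<g}))"
    and "\<forall>n>0. \<forall>A B :: nat \<Rightarrow> 'a mat.
           (\<forall>j<g. A j \<in> carrier_mat n n \<and> B j \<in> carrier_mat n n) \<longrightarrow>
           (\<forall>j<g. A j * B j = 1\<^sub>m n) \<longrightarrow>
           eval_ncpoly n (case_var A B) f = 0\<^sub>m n n"
  then show "f \<in> Idl\<^bsub>free_algebra (XY {..<g})\<^esub>
              ((\<lambda>j. 1 - ncvar (X j) * ncvar (Y j)) ` {..<g} \<union>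
               (\<lambda>j. 1 - ncvar (Y j) * ncvar (X j)) ` {..<g})"
    by (intro nullstellensatz_invertible_matrices) simp_all
next
  fix f :: "(nat var, 'a) ncpoly"
  assume "g \<noteq> 1" and "f \<in> carrier (free_algebra (XY {..<g}))"
    and "\<forall>n>0. \<forall>A B :: nat \<Rightarrow> 'a mat.
           (\<forall>j<g. A j \<in> carrier_mat n n \<and> B j \<in> carrier_mat n n) \<longrightarrow>
           finsum (module_mat TYPE('a) n n) (\<lambda>j. A j * B j) {..<g} = 1\<^sub>m n \<longrightarrow>
           eval_ncpoly n (case_var A B) f = 0\<^sub>m n n"
  then show "f \<in> Idl\<^bsub>free_algebra (XY {..<g})\<^esub> {1 - (\<Sum>j<g. ncvar (X j) * ncvar (Y j))}"
    by (intro nullstellensatz_right_invertible_row) simp_all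
next
  fix f :: "((nat \<times> nat) var, 'a) ncpoly"
  assume "f \<in> carrier (free_algebra (XY ({..<g} \<times> {..<g})))"
    and "\<forall>n>0. \<forall>A B :: nat \<times> nat \<Rightarrow> 'a mat.
           (\<forall>i<g. \<forall>j<g. A (i, j) \<in> carrier_mat n n \<and> B (i, j) \<in> carrier_mat n n) \<longrightarrow>
           block_mat g n A * block_mat g n B = 1\<^sub>m (g * n) \<longrightarrow>
           eval_ncpoly n (case_var A B) f = 0\<^sub>m n n"
  then show "f \<in> Idl\<^bsub>free_algebra (XY ({..<g} \<times> {..<g}))\<^esub>
              ((\<lambda>(i, j). of_bool (i = j) - (\<Sum>k<g. ncvar (X (i, k)) * ncvar (Y (k, j))))
                 ` ({..<g} \<times> {..<g}) \<union>
               (\<lambda>(i, j). of_bool (i = j) - (\<Sum>k<g. ncvar (Y (i, k)) * ncvar (X (k, j))))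
                 ` ({..<g} \<times> {..<g}))"
    by (intro nullstellensatz_invertible_block_matrix) simp_all
qed

end
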